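(* Let $\mathbb{K}$ be a finite extension of $\mathbb{Q}_p$ with residue field of cardinality $q$, let $\Gamma\subset\mathrm{PGL}_2(\mathbb{K})$ be a $p$-adic Schottky group, $\Delta_{\mathbb{K}}$ the Bruhat--Tits tree, and $f\in\Theta(\Gamma)$ a theta function. The function $g:\Delta_{\mathbb{K}}^0\to\mathbb{Z}$ associated to $f$, $g(v)=\log_q\|f\|_{\Lambda^{-1}(v)}$, is an integer valued rational virtual graph weight, with $\lambda(e)=N_e^{-1}$.
   Context: A $p$-adic Schottky group is a finitely generated, discrete, torsion-free subgroup $\Gamma\subset\mathrm{PGL}_2(\mathbb{K})$ all of whose nontrivial elements are hyperbolic. $\Lambda_\Gamma\subset\mathbb{P}^1(\mathbb{K})$ is the closure of the set of fixed points of nontrivial elements of $\Gamma$, and $\Omega_\Gamma=\mathbb{P}^1\smallsetminus\Lambda_\Gamma$. A theta function is an invertible holomorphic (rigid analytic) function $f\in\mathcal{O}(\Omega_\Gamma)^*$ with $f(\gamma z)=c(\gamma)f(z)$ for all $\gamma\in\Gamma$, for some $c\in\mathrm{Hom}(\Gamma,\mathbb{K}^* )$; $\Theta(\Gamma)$ is the group of these. $\Lambda:\mathbb{P}^1_{\mathbb{K}}\smallsetminus\mathbb{P}^1(\mathbb{K})\to\Delta_{\mathbb{K}}$ is the canonical map from Drinfeld's $p$-adic upper half plane to the tree, and $\|f\|_{\Lambda^{-1}(v)}=\sup_{z\in\Lambda^{-1}(v)}|f(z)|$ with $|\pi|=q^{-1}$ for a uniformizer $\pi$. $\Delta_{\mathbb{K}}^0$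 is the set of vertices and $\Delta_{\mathbb{K}}^1$ the set of oriented edges $e$ (each edge taken with both orientations) with source $s(e)$ and range $r(e)$; $N_e=\#\{e':s(e')=s(e)\}$. On a graph $E$ an inhomogeneous graph weight is a triple $(g,\lambda,\chi)$ of functions $g:E^0\to[0,\infty)$, $\lambda,\chi:E^1\to[0,\infty)$ with $g(v)+d\chi(v)=\sum_{s(e)=v}\lambda(e)g(r(e))$ for all vertices $v$, where $d\chi(v)=\sum_{s(e)=v}\chi(e)$. A rational virtual graph weight is a pair $(g,\lambda)$ of functions $g:E^0\to\mathbb{Q}$, $\lambda:E^1\to\mathbb{Q}\cap[0,\infty)$ such that there exist rational valued inhomogeneous graph weights $(g^{\pm},\lambda,\chi)$ with $g(v)=g^+(v)-g^-(v)$ for all $v\in E^0$. *)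

theory Defs
  imports
    "HOL-Analysis.Analysis"
    "HOL-Algebra.Generated_Groups"
    "HOL-Computational_Algebra.Computational_Algebra"
    "Graph_Theory.Digraph"
begin

section \<open>Finite extensions of the p-adic numbers\<close>

definition abs_topology :: "('c::field \<Rightarrow> real) \<Rightarrow> 'c topology" where
  "abs_topology absv = Metric_space.mtopology UNIV (\<lambda>x y. absv (x - y))"

definition integer_ring :: "('c::field \<Rightarrow> real) \<Rightarrow> 'c set \<Rightarrow> 'c set" where
  "integer_ring absv K = {x \<in> K. absv x \<le> 1}"

definition residue_card :: "('c::field \<Rightarrow> real) \<Rightarrow> 'c set \<Rightarrow> nat" where
  "residue_card absv K = card (integer_ring absv K //
     {(x, y). x \<in> integer_ring absv K \<and> y \<in> integer_ring absv K \<and> absv (x - y) < 1})"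

definition uniformizer :: "('c::field \<Rightarrow> real) \<Rightarrow> 'c set \<Rightarrow> 'c \<Rightarrow> bool" where
  "uniformizer absv K u \<longleftrightarrow> u \<in> K \<and> 0 < absv u \<and> absv u < 1 \<and>
     (\<forall>x\<in>K. absv x < 1 \<longrightarrow> absv x \<le> absv u)"

locale nonarchimedean_abs =
  fixes absv :: "'c::{alg_closed_field, field_char_0} \<Rightarrow> real"
  assumes abs_nonneg: "0 \<le> absv x"
    and abs_zero_iff: "absv x = 0 \<longleftrightarrow> x = 0"
    and abs_mult: "absv (x * y) = absv x * absv y"
    and abs_ultrametric: "absv (x + y) \<le> max (absv x) (absv y)"

text \<open>
  The field \<open>K\<close> is realised inside the completion of its own algebraic closure, which is the
  whole type \<open>'c\<close>: the type is algebraically closed, complete for \<open>absv\<close>, and the elements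
  algebraic over \<open>K\<close> are dense in it. The closure of the prime field \<open>\<rat>\<close> in the complete field
  \<open>'c\<close> is the completion of \<open>\<rat>\<close> for a power of the \<open>p\<close>-adic absolute value, i.e. the field
  of \<open>p\<close>-adic numbers.
\<close>

definition padic_numbers :: "('c::field_char_0 \<Rightarrow> real) \<Rightarrow> 'c set" where
  "padic_numbers absv = abs_topology absv closure_of \<rat>"

locale padic_field = nonarchimedean_abs absv
  for absv :: "'c::{alg_closed_field, field_char_0} \<Rightarrow> real" +
  fixes K :: "'c set" and p :: nat
  assumes p_prime: "prime p"
    and abs_p: "absv (of_nat p) < 1"
    and abs_int: "n \<noteq> 0 \<Longrightarrow> absv (of_int n) = absv (of_nat p) ^ multiplicity (int p) n"
    and complete: "Metric_space.mcomplete UNIV (\<lambda>x y. absv (x - y))"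
    and one_mem: "1 \<in> K"
    and diff_mem: "x \<in> K \<Longrightarrow> y \<in> K \<Longrightarrow> x - y \<in> K"
    and mult_mem: "x \<in> K \<Longrightarrow> y \<in> K \<Longrightarrow> x * y \<in> K"
    and inverse_mem: "x \<in> K \<Longrightarrow> inverse x \<in> K"
    and padic_subset: "padic_numbers absv \<subseteq> K"
    and finite_extension: "\<exists>B. finite B \<and> B \<subseteq> K \<and>
          (\<forall>x\<in>K. \<exists>a. (\<forall>b\<in>B. a b \<in> padic_numbers absv) \<and> x = (\<Sum>b\<in>B. a b * b))"
    and algebraic_dense: "abs_topology absv closure_of
          {x. \<exists>P. P \<noteq> 0 \<and> (\<forall>i. coeff P i \<in> K) \<and> poly P x = 0} = UNIV"
    and normalised: "\<exists>u. uniformizer absv K u \<and> absv u = 1 / real (residue_card absv K)"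


section \<open>The projective line and the projective linear group\<close>

text \<open>
  Points of the projective line over \<open>'c\<close> in the affine coordinate \<open>z = x / y\<close> of \<open>[x : y]\<close>.
\<close>

datatype 'c proj = Affine 'c | Infinity

fun hcoord :: "'c::field proj \<Rightarrow> 'c ^ 2" where
  "hcoord (Affine z) = vector [z, 1]"
| "hcoord Infinity = vector [1, 0]"

definition proj_point :: "'c::field ^ 2 \<Rightarrow> 'c proj" where
  "proj_point w = (if w $ 2 = 0 then Infinity else Affine (w $ 1 / w $ 2))"

definition P1 :: "'c set \<Rightarrow> 'c proj set" where
  "P1 K = insert Infinity (Affine ` K)"

definition wedge :: "'c::field ^ 2 \<Rightarrow> 'c ^ 2 \<Rightarrow> 'c" where
  "wedge v w = v $ 1 * w $ 2 - v $ 2 * w $ 1"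

text \<open>
  The chordal metric on the projective line; it induces the quotient topology of the space of
  nonzero vectors.
\<close>

definition chordal :: "('c::field \<Rightarrow> real) \<Rightarrow> 'c proj \<Rightarrow> 'c proj \<Rightarrow> real" where
  "chordal absv a b = absv (wedge (hcoord a) (hcoord b)) /
     (max (absv (hcoord a $ 1)) (absv (hcoord a $ 2)) *
      max (absv (hcoord b $ 1)) (absv (hcoord b $ 2)))"

definition GL2 :: "'c::field set \<Rightarrow> ('c ^ 2 ^ 2) monoid" where
  "GL2 K = \<lparr>carrier = {A. (\<forall>i j. A $ i $ j \<in> K) \<and> det A \<noteq> 0}, mult = (**), one = mat 1\<rparr>"

definition scalar_matrices :: "'c::field set \<Rightarrow> ('c ^ 2 ^ 2) set" where
  "scalar_matrices K = {mat c | c. c \<in> K \<and> c \<noteq> 0}"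

definition PGL2 :: "'c::field set \<Rightarrow> ('c ^ 2 ^ 2) set monoid" where
  "PGL2 K = GL2 K Mod scalar_matrices K"

definition moebius :: "'c::field ^ 2 ^ 2 \<Rightarrow> 'c proj \<Rightarrow> 'c proj" where
  "moebius A z = proj_point (A *v hcoord z)"

text \<open>
  An element of the projective group is a coset, i.e. a set of proportional matrices, all of
  which act by the same Moebius transformation.
\<close>

definition act :: "('c::field ^ 2 ^ 2) set \<Rightarrow> 'c proj \<Rightarrow> 'c proj" where
  "act \<gamma> z = moebius (SOME A. A \<in> \<gamma>) z"

definition GL2_topology :: "('c::field \<Rightarrow> real) \<Rightarrow> 'c set \<Rightarrow> ('c ^ 2 ^ 2) topology" where
  "GL2_topology absv K = subtopology
     (Metric_space.mtopology UNIV (\<lambda>A B. Max {absv (A $ i $ j - B $ i $ j) | i j. True}))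
     (carrier (GL2 K))"

text \<open>The open sets of the quotient topology on the projective group.\<close>

definition PGL2_open :: "('c::field \<Rightarrow> real) \<Rightarrow> 'c set \<Rightarrow> ('c ^ 2 ^ 2) set set \<Rightarrow> bool" where
  "PGL2_open absv K U \<longleftrightarrow> U \<subseteq> carrier (PGL2 K) \<and> openin (GL2_topology absv K) (\<Union>U)"


section \<open>Schottky groups and theta functions\<close>

definition hyperbolic :: "('c::field \<Rightarrow> real) \<Rightarrow> ('c ^ 2 ^ 2) set \<Rightarrow> bool" where
  "hyperbolic absv \<gamma> \<longleftrightarrow> (\<exists>A\<in>\<gamma>. \<exists>\<mu> \<nu> v w. v \<noteq> 0 \<and> A *v v = \<mu> *s v \<and>
      w \<noteq> 0 \<and> A *v w = \<nu> *s w \<and> absv \<mu> \<noteq> absv \<nu>)"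

definition schottky_group ::
    "('c::field \<Rightarrow> real) \<Rightarrow> 'c set \<Rightarrow> ('c ^ 2 ^ 2) set set \<Rightarrow> bool" where
  "schottky_group absv K \<Gamma> \<longleftrightarrow>
     subgroup \<Gamma> (PGL2 K) \<and>
     (\<exists>S. finite S \<and> S \<subseteq> \<Gamma> \<and> generate (PGL2 K) S = \<Gamma>) \<and>
     (\<forall>\<gamma>\<in>\<Gamma>. \<exists>U. PGL2_open absv K U \<and> U \<inter> \<Gamma> = {\<gamma>}) \<and>
     (\<forall>\<gamma>\<in>\<Gamma>. \<gamma> \<noteq> \<one>\<^bsub>PGL2 K\<^esub> \<longrightarrow> (\<forall>n::nat. n > 0 \<longrightarrow> \<gamma> [^]\<^bsub>PGL2 K\<^esub> n \<noteq> \<one>\<^bsub>PGL2 K\<^esub>)) \<and>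
     (\<forall>\<gamma>\<in>\<Gamma>. \<gamma> \<noteq> \<one>\<^bsub>PGL2 K\<^esub> \<longrightarrow> hyperbolic absv \<gamma>)"

definition limit_set ::
    "('c::field \<Rightarrow> real) \<Rightarrow> 'c set \<Rightarrow> ('c ^ 2 ^ 2) set set \<Rightarrow> 'c proj set" where
  "limit_set absv K \<Gamma> =
     subtopology (Metric_space.mtopology UNIV (chordal absv)) (P1 K) closure_of
       {z. \<exists>\<gamma>\<in>\<Gamma>. \<gamma> \<noteq> \<one>\<^bsub>PGL2 K\<^esub> \<and> act \<gamma> z = z}"

definition form_value :: "nat \<Rightarrow> 'c::field poly \<Rightarrow> 'c proj \<Rightarrow> 'c" where
  "form_value d P z = (\<Sum>i\<le>d. coeff P i * (hcoord z $ 1) ^ i * (hcoord z $ 2) ^ (d - i))"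

text \<open>
  Rational functions over \<open>K\<close> without poles in \<open>S\<close>, written as quotients of binary forms of the
  same degree \<open>d\<close> (the homogenisations of \<open>P\<close> and \<open>Q\<close>), so that \<open>Infinity\<close> is a point like any
  other.
\<close>

definition regular_rational :: "'c::field set \<Rightarrow> 'c proj set \<Rightarrow> ('c proj \<Rightarrow> 'c) set" where
  "regular_rational K S = {\<lambda>z. form_value d P z / form_value d Q z | d P Q.
     degree P \<le> d \<and> degree Q \<le> d \<and> (\<forall>i. coeff P i \<in> K \<and> coeff Q i \<in> K) \<and>
     (\<forall>z\<in>S. form_value d Q z \<noteq> 0)}"

text \<open>
  For a compact set \<open>L\<close> of \<open>K\<close>-rational points, the complement of \<open>L\<close> is the increasing union of
  the affinoids obtained by removing the open discs of radius \<open>\<epsilon>\<close> around the points of \<open>L\<close>. A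
  function is holomorphic over \<open>K\<close> on the complement of \<open>L\<close> if on each of these affinoids it
  is a uniform limit of rational functions over \<open>K\<close> without poles there.
\<close>

definition affinoid :: "('c::field \<Rightarrow> real) \<Rightarrow> 'c proj set \<Rightarrow> real \<Rightarrow> 'c proj set" where
  "affinoid absv L \<epsilon> = {z. \<forall>x\<in>L. chordal absv z x \<ge> \<epsilon>}"

definition holomorphic_off ::
    "('c::field \<Rightarrow> real) \<Rightarrow> 'c set \<Rightarrow> 'c proj set \<Rightarrow> ('c proj \<Rightarrow> 'c) set" where
  "holomorphic_off absv K L = {f. \<forall>\<epsilon>>0. \<forall>\<delta>>0.
     \<exists>R\<in>regular_rational K (affinoid absv L \<epsilon>).
       \<forall>z\<in>affinoid absv L \<epsilon>. absv (f z - R z) < \<delta>}"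

definition holomorphic_units ::
    "('c::field \<Rightarrow> real) \<Rightarrow> 'c set \<Rightarrow> 'c proj set \<Rightarrow> ('c proj \<Rightarrow> 'c) set" where
  "holomorphic_units absv K L = {f \<in> holomorphic_off absv K L.
     \<exists>h\<in>holomorphic_off absv K L. \<forall>z\<in>- L. f z * h z = 1}"

definition unit_group :: "'c::field set \<Rightarrow> 'c monoid" where
  "unit_group K = \<lparr>carrier = K - {0}, mult = (*), one = 1\<rparr>"

text \<open>
  Elements are functions on the whole projective line, of which only the values off the limit
  set are relevant.
\<close>

definition theta_functions ::
    "('c::field \<Rightarrow> real) \<Rightarrow> 'c set \<Rightarrow> ('c ^ 2 ^ 2) set set \<Rightarrow> ('c proj \<Rightarrow> 'c) set" where
  "theta_functions absv K \<Gamma> = {f \<in> holomorphic_units absv K (limit_set absv K \<Gamma>).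
     \<exists>c\<in>hom ((PGL2 K)\<lparr>carrier := \<Gamma>\<rparr>) (unit_group K).
       \<forall>\<gamma>\<in>\<Gamma>. \<forall>z\<in>- limit_set absv K \<Gamma>. f (act \<gamma> z) = c \<gamma> * f z}"


section \<open>The Bruhat--Tits tree\<close>

definition K2 :: "'c set \<Rightarrow> ('c ^ 2) set" where
  "K2 K = {w. \<forall>i. w $ i \<in> K}"

definition lattices :: "('c::field \<Rightarrow> real) \<Rightarrow> 'c set \<Rightarrow> ('c ^ 2) set set" where
  "lattices absv K = {{a *s v + b *s w | a b. a \<in> integer_ring absv K \<and> b \<in> integer_ring absv K} | v w.
     v \<in> K2 K \<and> w \<in> K2 K \<and> wedge v w \<noteq> 0}"

definition lattice_class :: "'c::field set \<Rightarrow> ('c ^ 2) set \<Rightarrow> ('c ^ 2) set set" where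
  "lattice_class K M = {(*s) c ` M | c. c \<in> K \<and> c \<noteq> 0}"

definition bt_vertices :: "('c::field \<Rightarrow> real) \<Rightarrow> 'c set \<Rightarrow> ('c ^ 2) set set set" where
  "bt_vertices absv K = lattice_class K ` lattices absv K"

definition bt_adjacent ::
    "('c::field \<Rightarrow> real) \<Rightarrow> 'c set \<Rightarrow> ('c ^ 2) set set \<Rightarrow> ('c ^ 2) set set \<Rightarrow> bool" where
  "bt_adjacent absv K x y \<longleftrightarrow>
     (\<exists>u M N. uniformizer absv K u \<and> M \<in> x \<and> N \<in> y \<and> (*s) u ` M \<subset> N \<and> N \<subset> M)"

text \<open>
  The adjacency relation is symmetric, so every geometric edge occurs with both orientations.
\<close>

definition bt_tree :: "('c::field \<Rightarrow> real) \<Rightarrow> 'c set \<Rightarrow>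
    (('c ^ 2) set set, ('c ^ 2) set set \<times> ('c ^ 2) set set) pre_digraph" where
  "bt_tree absv K = \<lparr>verts = bt_vertices absv K,
     arcs = {(x, y). x \<in> bt_vertices absv K \<and> y \<in> bt_vertices absv K \<and> bt_adjacent absv K x y},
     tail = fst, head = snd\<rparr>"


section \<open>The map from the p-adic upper half plane to the tree\<close>

text \<open>
  By Goldman and Iwahori, the points of the geometric realisation of the tree are the
  homothety classes of norms on \<open>K\<^sup>2\<close>; the vertex given by a lattice \<open>M\<close> corresponds to the
  class of the gauge of \<open>M\<close>. The canonical map sends a point \<open>[x : y]\<close> which is not
  \<open>K\<close>-rational to the class of the norm \<open>w \<mapsto> \<bar>w\<^sub>1 y - w\<^sub>2 x\<bar>\<close>. Using this functional, and not
  \<open>w\<^sub>1 x + w\<^sub>2 y\<close>, makes the map equivariant for the actions of \<open>GL\<^sub>2(K)\<close> on column vectors,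
  lattices and points used above.
\<close>

definition norm_class :: "'c::field set \<Rightarrow> ('c ^ 2 \<Rightarrow> real) \<Rightarrow> ('c ^ 2 \<Rightarrow> real) set" where
  "norm_class K \<alpha> = {\<beta>. \<exists>t>0. \<forall>w\<in>K2 K. \<beta> w = t * \<alpha> w}"

definition lattice_norm ::
    "('c::field \<Rightarrow> real) \<Rightarrow> 'c set \<Rightarrow> ('c ^ 2) set \<Rightarrow> 'c ^ 2 \<Rightarrow> real" where
  "lattice_norm absv K M w = Inf {absv c | c. c \<in> K \<and> w \<in> (*s) c ` M}"

definition vertex_point ::
    "('c::field \<Rightarrow> real) \<Rightarrow> 'c set \<Rightarrow> ('c ^ 2) set set \<Rightarrow> ('c ^ 2 \<Rightarrow> real) set" where
  "vertex_point absv K x = norm_class K (lattice_norm absv K (SOME M. M \<in> x))"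

definition drinfeld_map ::
    "('c::field \<Rightarrow> real) \<Rightarrow> 'c set \<Rightarrow> 'c proj \<Rightarrow> ('c ^ 2 \<Rightarrow> real) set" where
  "drinfeld_map absv K z = norm_class K (\<lambda>w. absv (wedge w (hcoord z)))"

definition drinfeld_fibre ::
    "('c::field \<Rightarrow> real) \<Rightarrow> 'c set \<Rightarrow> ('c ^ 2) set set \<Rightarrow> 'c proj set" where
  "drinfeld_fibre absv K x = {z \<in> - P1 K. drinfeld_map absv K z = vertex_point absv K x}"

definition log_sup_norm ::
    "('c::field \<Rightarrow> real) \<Rightarrow> 'c set \<Rightarrow> ('c proj \<Rightarrow> 'c) \<Rightarrow> ('c ^ 2) set set \<Rightarrow> real" where
  "log_sup_norm absv K f x =
     log (real (residue_card absv K)) (SUP z\<in>drinfeld_fibre absv K x. absv (f z))"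


section \<open>Graph weights\<close>

text \<open>
  Local finiteness is part of the definition because it gives a meaning to the sums over the
  edges issuing from a vertex (\<^const>\<open>sum\<close> over an infinite set is 0).
\<close>

definition inhomogeneous_graph_weight ::
    "('v, 'e) pre_digraph \<Rightarrow> ('v \<Rightarrow> real) \<Rightarrow> ('e \<Rightarrow> real) \<Rightarrow> ('e \<Rightarrow> real) \<Rightarrow> bool" where
  "inhomogeneous_graph_weight E g l \<xi> \<longleftrightarrow>
     (\<forall>v\<in>verts E. finite (out_arcs E v)) \<and>
     (\<forall>v\<in>verts E. 0 \<le> g v) \<and> (\<forall>e\<in>arcs E. 0 \<le> l e \<and> 0 \<le> \<xi> e) \<and>
     (\<forall>v\<in>verts E. g v + (\<Sum>e\<in>out_arcs E v. \<xi> e) = (\<Sum>e\<in>out_arcs E v. l e * g (head E e)))"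

definition rational_virtual_graph_weight ::
    "('v, 'e) pre_digraph \<Rightarrow> ('v \<Rightarrow> real) \<Rightarrow> ('e \<Rightarrow> real) \<Rightarrow> bool" where
  "rational_virtual_graph_weight E g l \<longleftrightarrow>
     (\<forall>v\<in>verts E. g v \<in> \<rat>) \<and> (\<forall>e\<in>arcs E. l e \<in> \<rat> \<and> 0 \<le> l e) \<and>
     (\<exists>g\<^sub>p g\<^sub>m \<xi>. inhomogeneous_graph_weight E g\<^sub>p l \<xi> \<and> inhomogeneous_graph_weight E g\<^sub>m l \<xi> \<and>
        (\<forall>v\<in>verts E. g\<^sub>p v \<in> \<rat> \<and> g\<^sub>m v \<in> \<rat>) \<and> (\<forall>e\<in>arcs E. \<xi> e \<in> \<rat>) \<and>
        (\<forall>v\<in>verts E. g v = g\<^sub>p v - g\<^sub>m v))"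

end

theory Submission
  imports Defs
begin

text \<open>
  A theta function \<open>f\<close> is a unit on the complement of a set \<open>L\<close> of \<open>K\<close>-rational points. For such a
  unit, \<open>log\<^sub>q \<parallel>f\<parallel>\<close> is an integer valued harmonic function on the vertices of the tree.

  Near finitely many vertices, \<open>f\<close> and \<open>1/f\<close> are bounded, so \<open>\<bar>f\<bar>\<close> is the absolute value of a
  rational function over \<open>K\<close> all of whose zeros and poles lie in small discs around points of \<open>L\<close>.
  By the ultrametric inequality they may be moved to these points, and \<open>\<bar>f\<bar>\<close> becomes a constant times
  a quotient of products of chordal distances to rational points (\<open>absv_unit_on_affinoid\<close>). The
  constant is a quotient of Gauss norms, hence an absolute value of \<open>K\<close>, i.e. a power of \<open>q\<close>.

  On the fibre over the vertex of a lattice \<open>M\<close> the distance to a rational point \<open>x\<close> is, up to a factor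
  common to all \<open>x\<close>, the norm of a representing vector with respect to \<open>M\<close>. There are as many zeros
  as poles, so the common factors cancel: \<open>\<bar>f\<bar>\<close> is constant on the fibre, and its logarithm is an
  integer plus a sum of differences of logarithms of lattice norms (\<open>log_sup_norm_unit\<close>).

  The logarithm of the norm of a fixed vector is almost harmonic in the lattice. The neighbours of
  \<open>M\<close> are the lattices between \<open>M\<close> and its multiple by a uniformizer. A primitive vector of \<open>M\<close>
  lies in exactly one of them and has norm \<open>q\<close> at the others (\<open>sum_log_norm_neighbours\<close>). The
  deviation from harmonicity is the same for all vectors and disappears in the differences.

  Finally, a harmonic function \<open>g\<close> is the difference of \<open>max g 0\<close> and \<open>max (- g) 0\<close>, two subharmonic
  functions with equal defect (\<open>harmonic_imp_rational_virtual_graph_weight\<close>).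
\<close>

section \<open>Ultrametric absolute values and the chordal distance\<close>

context nonarchimedean_abs
begin

lemma absv_zero [simp]: "absv 0 = 0"
  using abs_zero_iff by simp

lemma absv_pos_iff [simp]: "0 < absv x \<longleftrightarrow> x \<noteq> 0"
  using abs_nonneg[of x] abs_zero_iff[of x] by linarith

lemma absv_one [simp]: "absv 1 = 1"
proof -
  have "absv 1 * absv 1 = absv 1" using abs_mult[of 1 1] by simp
  moreover have "absv 1 \<noteq> 0" using abs_zero_iff by simp
  ultimately show ?thesis by simp
qed

lemma absv_minus [simp]: "absv (- x) = absv x"
proof -
  have "absv (-1) * absv (-1) = 1" using abs_mult[of "-1" "-1"] by simp
  then have "absv (-1) = 1" using abs_nonneg[of "-1"]
    by (metis abs_of_nonneg abs_mult_self_eq power2_eq_square real_sqrt_abs real_sqrt_one)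
  then show ?thesis using abs_mult[of "-1" x] by simp
qed

lemma absv_minus_commute: "absv (x - y) = absv (y - x)"
  using absv_minus[of "x - y"] by simp

lemma absv_inverse: "absv (inverse x) = inverse (absv x)"
proof (cases "x = 0")
  case False
  then have "absv x * absv (inverse x) = 1" using abs_mult[of x "inverse x"] by simp
  then show ?thesis by (metis inverse_unique)
qed simp

lemma absv_divide: "absv (x / y) = absv x / absv y"
  by (simp add: divide_inverse abs_mult absv_inverse)

lemma absv_power: "absv (x ^ n) = absv x ^ n"
  by (induction n) (auto simp: abs_mult)

lemma absv_power_int: "absv (x powi n) = absv x powi n"
  by (simp add: power_int_def absv_power absv_inverse)

lemma absv_prod: "absv (\<Prod>i\<in>A. f i) = (\<Prod>i\<in>A. absv (f i))"
  by (induction A rule: infinite_finite_induct) (auto simp: abs_mult)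

lemma absv_diff: "absv (x - y) \<le> max (absv x) (absv y)"
  using abs_ultrametric[of x "- y"] by simp

lemma absv_add_eq_left: "absv y < absv x \<Longrightarrow> absv (x + y) = absv x"
  using abs_ultrametric[of x y] absv_diff[of "x + y" y] by (auto simp: max_def split: if_splits)

lemma absv_diff_eq_left: "absv y < absv x \<Longrightarrow> absv (x - y) = absv x"
  using absv_add_eq_left[of "- y" x] by simp

lemma absv_diff_eq_right: "absv x < absv y \<Longrightarrow> absv (x - y) = absv y"
  using absv_diff_eq_left[of x y] absv_minus_commute by simp

lemma absv_eq_of_close: "absv (x - y) < absv x \<Longrightarrow> absv y = absv x"
  using absv_diff_eq_left[of "x - y" x] by simp

definition sup_norm :: "'c ^ 2 \<Rightarrow> real" where
  "sup_norm w = max (absv (w $ 1)) (absv (w $ 2))"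

lemma sup_norm_hcoord_pos: "0 < sup_norm (hcoord z)"
  by (cases z) (auto simp: sup_norm_def less_max_iff_disj)

lemma absv_wedge_le: "absv (wedge v w) \<le> sup_norm v * sup_norm w"
proof -
  have "absv (v $ i * w $ j) \<le> sup_norm v * sup_norm w" for i j
  proof -
    have "absv (v $ i) \<le> sup_norm v" "absv (w $ j) \<le> sup_norm w"
      using exhaust_2[of i] exhaust_2[of j] by (auto simp: sup_norm_def)
    then show ?thesis unfolding abs_mult
      by (intro mult_mono) (auto intro: order_trans[OF abs_nonneg] abs_nonneg)
  qed
  then show ?thesis unfolding wedge_def by (intro order_trans[OF absv_diff]) simp
qed

lemma chordal_eq:
  "chordal absv a b = absv (wedge (hcoord a) (hcoord b)) / (sup_norm (hcoord a) * sup_norm (hcoord b))"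
  by (simp add: chordal_def sup_norm_def)

lemma chordal_nonneg: "0 \<le> chordal absv a b"
  unfolding chordal_eq using sup_norm_hcoord_pos[of a] sup_norm_hcoord_pos[of b]
  by (simp add: abs_nonneg)

lemma chordal_le_1: "chordal absv a b \<le> 1"
  unfolding chordal_eq using absv_wedge_le sup_norm_hcoord_pos[of a] sup_norm_hcoord_pos[of b]
  by (simp add: divide_le_eq)

lemma chordal_commute: "chordal absv a b = chordal absv b a"
proof -
  have "wedge (hcoord a) (hcoord b) = - wedge (hcoord b) (hcoord a)"
    by (simp add: wedge_def algebra_simps)
  then show ?thesis unfolding chordal_eq by (simp add: mult.commute)
qed

lemma chordal_self [simp]: "chordal absv a a = 0"
  by (simp add: chordal_eq wedge_def mult.commute)

lemma absv_wedge_eq_chordal: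
  "absv (wedge (hcoord a) (hcoord b)) = chordal absv a b * sup_norm (hcoord a) * sup_norm (hcoord b)"
  using sup_norm_hcoord_pos[of a] sup_norm_hcoord_pos[of b] by (simp add: chordal_eq)

text \<open>
  The identity \<open>(a \<and> c) b = (a \<and> b) c + (b \<and> c) a\<close> between three vectors of the plane bounds one
  wedge product by the two others.
\<close>

lemma chordal_ultrametric:
  "chordal absv a c \<le> max (chordal absv a b) (chordal absv b c)"
proof -
  let ?a = "hcoord a" and ?b = "hcoord b" and ?c = "hcoord c"
  let ?M = "max (sup_norm ?c * absv (wedge ?a ?b)) (sup_norm ?a * absv (wedge ?b ?c))"
  have coord: "absv (wedge ?a ?c) * absv (?b $ i) \<le> ?M" for i
  proof -
    have le: "absv (v $ i) \<le> sup_norm v" for v :: "'c ^ 2"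
      using exhaust_2[of i] by (auto simp: sup_norm_def)
    have "wedge ?a ?c * ?b $ i = wedge ?a ?b * ?c $ i + wedge ?b ?c * ?a $ i"
      using exhaust_2[of i] by (auto simp: wedge_def algebra_simps)
    then have "absv (wedge ?a ?c) * absv (?b $ i)
        \<le> max (absv (wedge ?a ?b) * absv (?c $ i)) (absv (wedge ?b ?c) * absv (?a $ i))"
      by (metis abs_mult abs_ultrametric)
    also have "\<dots> \<le> ?M"
      using le[of ?c] le[of ?a] by (intro max.mono) (auto simp: mult.commute[of "absv (wedge _ _)"] abs_nonneg intro!: mult_right_mono)
    finally show ?thesis .
  qed
  have "absv (wedge ?a ?c) * sup_norm ?b \<le> ?M"
    using coord[of 1] coord[of 2] unfolding sup_norm_def[of ?b] by (cases "absv (?b $ 1) \<le> absv (?b $ 2)") (auto simp: max_def)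
  moreover have "?M = sup_norm ?a * sup_norm ?b * sup_norm ?c * max (chordal absv a b) (chordal absv b c)"
    unfolding absv_wedge_eq_chordal
    using sup_norm_hcoord_pos[of a] sup_norm_hcoord_pos[of b] sup_norm_hcoord_pos[of c]
    by (simp add: max_mult_distrib_left algebra_simps)
  moreover have "absv (wedge ?a ?c) * sup_norm ?b = sup_norm ?a * sup_norm ?b * sup_norm ?c * chordal absv a c"
    unfolding absv_wedge_eq_chordal by (simp add: algebra_simps)
  ultimately show ?thesis
    using sup_norm_hcoord_pos[of a] sup_norm_hcoord_pos[of b] sup_norm_hcoord_pos[of c]
    by (metis mult_le_cancel_left_pos mult_pos_pos)
qed

lemma chordal_eq_of_close:
  assumes "chordal absv b x < \<epsilon>" "\<epsilon> \<le> chordal absv z x"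
  shows "chordal absv b z = chordal absv x z"
  using chordal_ultrametric[of b z x] chordal_ultrametric[of x z b] assms
  by (auto simp: chordal_commute[of _ x] chordal_commute[of z] max_def split: if_splits)


section \<open>The Gauss norm and factorisation of binary forms\<close>

definition gauss_norm :: "'c poly \<Rightarrow> real" where
  "gauss_norm P = Max ((\<lambda>i. absv (coeff P i)) ` {..degree P})"

lemma gauss_norm_attained: "\<exists>i. gauss_norm P = absv (coeff P i)"
proof -
  have "gauss_norm P \<in> (\<lambda>i. absv (coeff P i)) ` {..degree P}"
    unfolding gauss_norm_def by (rule Max_in) auto
  then show ?thesis by auto
qed

lemma absv_coeff_le_gauss_norm: "absv (coeff P i) \<le> gauss_norm P"
proof (cases "i \<le> degree P")
  case False
  then show ?thesis using gauss_norm_attained[of P] by (auto simp: coeff_eq_0 abs_nonneg)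
qed (auto simp: gauss_norm_def)

lemma gauss_norm_eqI:
  "(\<And>i. absv (coeff P i) \<le> r) \<Longrightarrow> absv (coeff P j) = r \<Longrightarrow> gauss_norm P = r"
  by (metis antisym gauss_norm_attained absv_coeff_le_gauss_norm)

lemma gauss_norm_pos: "P \<noteq> 0 \<Longrightarrow> 0 < gauss_norm P"
  using absv_coeff_le_gauss_norm[of P "degree P"] absv_pos_iff[of "lead_coeff P"]
  by (metis leading_coeff_0_iff order_less_le_trans)

text \<open>
  The only case of Gauss's lemma that is needed. If \<open>\<bar>\<beta>\<bar> \<le> 1\<close>, the last coefficient of maximal
  absolute value of \<open>P\<close> survives in the next coefficient of the product; if \<open>\<bar>\<beta>\<bar> > 1\<close>, any
  coefficient of maximal absolute value, multiplied by \<open>\<beta>\<close>, dominates.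
\<close>

lemma gauss_norm_linear_mult:
  assumes "P \<noteq> 0"
  shows "gauss_norm ([:- \<beta>, 1:] * P) = max 1 (absv \<beta>) * gauss_norm P"
proof -
  let ?g = "gauss_norm P"
  have g: "0 < ?g" using assms by (rule gauss_norm_pos)
  have c: "coeff ([:- \<beta>, 1:] * P) i = (if i = 0 then 0 else coeff P (i - 1)) - \<beta> * coeff P i" for i
    by (cases i) auto
  have up: "absv (coeff ([:- \<beta>, 1:] * P) i) \<le> max 1 (absv \<beta>) * ?g" for i
  proof -
    have "absv (if i = 0 then 0 else coeff P (i - 1)) \<le> max 1 (absv \<beta>) * ?g"
    proof (cases "i = 0")
      case False
      have "?g \<le> max 1 (absv \<beta>) * ?g" using g by simp
      then show ?thesis using False absv_coeff_le_gauss_norm[of P "i - 1"] by simp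
    qed (use g in simp)
    moreover have "absv (\<beta> * coeff P i) \<le> max 1 (absv \<beta>) * ?g"
      unfolding abs_mult using absv_coeff_le_gauss_norm[of P i]
      by (intro mult_mono) (auto simp: abs_nonneg)
    ultimately show ?thesis unfolding c by (intro order_trans[OF absv_diff]) simp
  qed
  show ?thesis
  proof (cases "absv \<beta> \<le> 1")
    case True
    define S where "S = {i. absv (coeff P i) = ?g}"
    have "S \<subseteq> {..degree P}" using g by (auto simp: S_def intro: le_degree)
    then have fin: "finite S" using finite_subset by blast
    have "S \<noteq> {}" using gauss_norm_attained[of P] by (auto simp: S_def)
    then have m: "Max S \<in> S" "Suc (Max S) \<notin> S"
      using fin by (metis Max_in, metis Max_ge Suc_n_not_le_n)
    have "absv (\<beta> * coeff P (Suc (Max S))) \<le> absv (coeff P (Suc (Max S)))"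
      using mult_right_mono[OF True abs_nonneg] by (simp add: abs_mult)
    also have "\<dots> < ?g" using m(2) absv_coeff_le_gauss_norm[of P "Suc (Max S)"] by (auto simp: S_def)
    also have "\<dots> = absv (coeff P (Max S))" using m(1) by (simp add: S_def)
    finally have "absv (coeff ([:- \<beta>, 1:] * P) (Suc (Max S))) = absv (coeff P (Max S))"
      unfolding c by (simp add: absv_diff_eq_left)
    then show ?thesis using up m(1) True by (intro gauss_norm_eqI[where j = "Suc (Max S)"]) (auto simp: S_def)
  next
    case False
    obtain i where i: "?g = absv (coeff P i)" using gauss_norm_attained by blast
    have "absv (if i = 0 then 0 else coeff P (i - 1)) \<le> ?g"
      using absv_coeff_le_gauss_norm[of P "i - 1"] g by auto
    also have "?g < absv \<beta> * ?g" using False g by simp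
    also have "\<dots> = absv (\<beta> * coeff P i)" using i by (simp add: abs_mult)
    finally have "absv (coeff ([:- \<beta>, 1:] * P) i) = absv (\<beta> * coeff P i)"
      unfolding c by (simp add: absv_diff_eq_right)
    then show ?thesis using up False i
      by (intro gauss_norm_eqI[where j = i]) (auto simp: abs_mult)
  qed
qed

lemma form_value_Suc:
  assumes "degree P \<le> d"
  shows "form_value (Suc d) P z = hcoord z $ 2 * form_value d P z"
proof -
  have "coeff P (Suc d) = 0" using assms by (simp add: coeff_eq_0)
  then show ?thesis
    by (auto simp: form_value_def sum_distrib_left Suc_diff_le mult_ac intro!: sum.cong)
qed

lemma form_value_pCons_0:
  "form_value (Suc d) (pCons 0 P) z = hcoord z $ 1 * form_value d P z"
  by (auto simp: form_value_def sum.atMost_Suc_shift sum_distrib_left mult_ac simp del: sum.atMost_Suc intro!: sum.cong)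

lemma form_value_linear_mult:
  assumes "degree P \<le> d"
  shows "form_value (Suc d) ([:- \<beta>, 1:] * P) z
    = (hcoord z $ 1 - \<beta> * hcoord z $ 2) * form_value d P z"
proof -
  have "form_value (Suc d) ([:- \<beta>, 1:] * P) z
    = form_value (Suc d) (pCons 0 P) z - \<beta> * form_value (Suc d) P z"
    unfolding form_value_def sum_distrib_left sum_subtractf[symmetric]
    by (intro sum.cong) (auto simp: algebra_simps)
  then show ?thesis using assms by (simp add: form_value_Suc form_value_pCons_0 algebra_simps)
qed

text \<open>
  Over an algebraically closed field a binary form splits into linear forms. Measured by chordal
  distances to the roots, the constant in front is the Gauss norm, hence the absolute value of one
  of the coefficients; this is what makes it a value of the absolute value on the field of
  definition, although the roots lie outside that field in general.
\<close>

lemma absv_form_value: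
  assumes "P \<noteq> 0" "degree P \<le> d"
  shows "\<exists>b. \<forall>z. absv (form_value d P z)
    = gauss_norm P * sup_norm (hcoord z) ^ d * (\<Prod>i<d. chordal absv (b i) z)"
  using assms
proof (induction d arbitrary: P)
  case 0
  then obtain a where "P = [:a:]" by (metis degree_eq_zeroE le_zero_eq)
  then show ?case by (auto simp: form_value_def gauss_norm_def)
next
  case (Suc d)
  \<comment> \<open>A form of degree \<open>Suc d\<close> has a root \<open>r\<close>: the point at infinity if the polynomial has a
    smaller degree, and a root of the polynomial otherwise.\<close>
  obtain r Q where Q: "Q \<noteq> 0" "degree Q \<le> d" and
    step: "\<And>z. absv (form_value (Suc d) P z) * gauss_norm Q
        = gauss_norm P * (chordal absv r z * sup_norm (hcoord z)) * absv (form_value d Q z)"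
  proof (cases "degree P \<le> d")
    case True
    have "absv (hcoord z $ 2) = chordal absv Infinity z * sup_norm (hcoord z)" for z
      using absv_wedge_eq_chordal[of Infinity z] by (simp add: wedge_def sup_norm_def[of "vector _"])
    then show ?thesis using True Suc.prems form_value_Suc[OF True]
      by (intro that[of P Infinity]) (auto simp: abs_mult)
  next
    case False
    then obtain \<beta> where "poly P \<beta> = 0"
      using alg_closed_imp_poly_has_root[of P] Suc.prems by auto
    then obtain Q where PQ: "P = [:- \<beta>, 1:] * Q" using poly_eq_0_iff_dvd by (auto simp: dvd_def)
    have Q0: "Q \<noteq> 0" using Suc.prems PQ by auto
    have "degree P = Suc (degree Q)" unfolding PQ using Q0 by (subst degree_mult_eq) auto
    then have Qd: "degree Q \<le> d" using Suc.prems by simp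
    have "absv (hcoord z $ 1 - \<beta> * hcoord z $ 2)
        = max 1 (absv \<beta>) * (chordal absv (Affine \<beta>) z * sup_norm (hcoord z))" for z
      using absv_wedge_eq_chordal[of "Affine \<beta>" z]
      by (simp add: wedge_def sup_norm_def[of "vector _"] absv_minus_commute max.commute algebra_simps)
    then show ?thesis
      using Q0 Qd form_value_linear_mult[OF Qd, of \<beta>] gauss_norm_linear_mult[OF Q0, of \<beta>]
      by (intro that[of Q "Affine \<beta>"]) (auto simp: PQ abs_mult)
  qed
  obtain b where b: "\<And>z. absv (form_value d Q z)
      = gauss_norm Q * sup_norm (hcoord z) ^ d * (\<Prod>i<d. chordal absv (b i) z)"
    using Suc.IH[OF Q] by blast
  have "absv (form_value (Suc d) P z)
      = gauss_norm P * sup_norm (hcoord z) ^ Suc d * (\<Prod>i<Suc d. chordal absv ((b(d := r)) i) z)" for z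
  proof -
    have "absv (form_value (Suc d) P z) * gauss_norm Q =
      (gauss_norm P * sup_norm (hcoord z) ^ Suc d * (\<Prod>i<Suc d. chordal absv ((b(d := r)) i) z)) * gauss_norm Q"
      unfolding step b by (simp add: mult_ac)
    then show ?thesis using gauss_norm_pos[OF Q(1)] by simp
  qed
  then show ?case by blast
qed

end


section \<open>Value group and residue field of a local field\<close>

context padic_field
begin

definition residue_size :: real where
  "residue_size = real (residue_card absv K)"

definition unif :: 'c where
  "unif = (SOME u. uniformizer absv K u \<and> absv u = 1 / residue_size)"

lemma unif: "uniformizer absv K unif" "absv unif = 1 / residue_size"
  using someI_ex[OF normalised] unfolding unif_def residue_size_def by auto

lemma absv_unif: "0 < absv unif" "absv unif < 1"
  using unif(1) by (auto simp: uniformizer_def)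

lemma unif_mem: "unif \<in> K"
  using unif(1) by (auto simp: uniformizer_def)

lemma unif_nonzero: "unif \<noteq> 0"
  using absv_unif(1) by auto

lemma absv_le_unif: "x \<in> K \<Longrightarrow> absv x < 1 \<Longrightarrow> absv x \<le> absv unif"
  using unif(1) by (auto simp: uniformizer_def)

lemma absv_uniformizer: "uniformizer absv K u \<Longrightarrow> absv u = absv unif"
  using unif(1) by (intro antisym) (auto simp: uniformizer_def)

lemma residue_size_gt_1: "1 < residue_size"
proof -
  have "0 < residue_size" using absv_unif(1) unfolding unif(2) by simp
  then show ?thesis using absv_unif(2) unfolding unif(2) by (simp add: field_simps)
qed

lemma zero_mem: "0 \<in> K"
  using diff_mem[OF one_mem one_mem] by simp

lemma minus_mem: "x \<in> K \<Longrightarrow> - x \<in> K"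
  using diff_mem[OF zero_mem, of x] by simp

lemma add_mem: "x \<in> K \<Longrightarrow> y \<in> K \<Longrightarrow> x + y \<in> K"
  using diff_mem[of x "- y"] minus_mem by simp

lemma divide_mem: "x \<in> K \<Longrightarrow> y \<in> K \<Longrightarrow> x / y \<in> K"
  by (simp add: divide_inverse mult_mem inverse_mem)

lemma power_int_mem: "x \<in> K \<Longrightarrow> x powi n \<in> K"
proof -
  have "y ^ k \<in> K" if "y \<in> K" for y k
    using that by (induction k) (auto intro: one_mem mult_mem)
  then show "x \<in> K \<Longrightarrow> x powi n \<in> K" by (auto simp: power_int_def inverse_mem)
qed

lemmas field_mem = zero_mem one_mem minus_mem add_mem diff_mem mult_mem divide_mem inverse_mem unif_mem

definition value_group :: "real set" where
  "value_group = range (\<lambda>n. residue_size powi n)"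

lemma value_group_pos: "r \<in> value_group \<Longrightarrow> 0 < r"
  using residue_size_gt_1 by (auto simp: value_group_def)

lemma value_group_divide: "r \<in> value_group \<Longrightarrow> s \<in> value_group \<Longrightarrow> r / s \<in> value_group"
  using residue_size_gt_1 by (auto simp: value_group_def power_int_diff[symmetric])

lemma log_value_group: "r \<in> value_group \<Longrightarrow> log residue_size r \<in> \<int>"
  using residue_size_gt_1 by (auto simp: value_group_def powr_real_of_int'[symmetric])

lemma value_group_gt_1: "r \<in> value_group \<Longrightarrow> 1 < r \<Longrightarrow> residue_size \<le> r"
proof -
  assume "r \<in> value_group" "1 < r"
  then obtain n where n: "r = residue_size powi n" by (auto simp: value_group_def)
  have "n \<ge> 1"
  proof (rule ccontr)
    assume "\<not> n \<ge> 1"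
    then have "residue_size powi n \<le> residue_size powi 0"
      using residue_size_gt_1 by (intro power_int_increasing) auto
    then show False using n \<open>1 < r\<close> by simp
  qed
  then have "residue_size powi 1 \<le> residue_size powi n"
    using residue_size_gt_1 by (intro power_int_increasing) auto
  then show ?thesis using n by simp
qed

lemma absv_in_value_group:
  assumes "x \<in> K" "x \<noteq> 0"
  shows "absv x \<in> value_group"
proof -
  define n where "n = \<lfloor>log residue_size (absv x)\<rfloor>"
  have bounds: "residue_size powi n \<le> absv x" "absv x < residue_size powi (n + 1)"
    using floor_log_eq_powr_iff[of "absv x" residue_size n] assms residue_size_gt_1
    by (auto simp: n_def powr_real_of_int'[symmetric])
  have pos: "0 < residue_size powi n" using residue_size_gt_1 by simp
  define y where "y = inverse (x * unif powi n)"
  have y: "absv y = residue_size powi n / absv x"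
    unfolding y_def absv_inverse abs_mult absv_power_int unif(2)
    by (simp add: power_int_one_over field_simps)
  have "y \<in> K" unfolding y_def using assms by (intro field_mem power_int_mem)
  moreover have "\<not> absv y \<le> absv unif"
    using bounds(2) residue_size_gt_1 assms unfolding y unif(2)
    by (simp add: field_simps power_int_add)
  moreover have "absv y \<le> 1" using bounds(1) assms by (simp add: y)
  ultimately have "absv y = 1" using absv_le_unif[of y] by linarith
  then have "absv x = residue_size powi n" using assms by (simp add: y field_simps)
  then show ?thesis by (simp add: value_group_def)
qed

lemma value_group_gap:
  assumes "r \<in> value_group" "s \<in> value_group" "r < s"
  shows "residue_size * r \<le> s"
  using value_group_gt_1[OF value_group_divide[OF assms(2,1)]] value_group_pos[OF assms(1)] assms(3)
  by (simp add: field_simps)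

lemma value_group_attained:
  assumes "r \<in> value_group"
  obtains c where "c \<in> K" "c \<noteq> 0" "absv c = r"
proof -
  obtain n where n: "r = residue_size powi n" using assms by (auto simp: value_group_def)
  have "absv (unif powi (- n)) = r"
    unfolding absv_power_int unif(2) n by (simp add: power_int_one_over power_int_minus field_simps)
  then show ?thesis
    using that[of "unif powi (- n)"] power_int_mem[OF unif_mem] unif_nonzero by simp
qed

abbreviation "\<O> \<equiv> integer_ring absv K"

lemma integer_ring_iff: "x \<in> \<O> \<longleftrightarrow> x \<in> K \<and> absv x \<le> 1"
  by (simp add: integer_ring_def)

lemma integer_ring_closed:
  assumes "a \<in> \<O>" "b \<in> \<O>"
  shows "a + b \<in> \<O>" "a - b \<in> \<O>" "a * b \<in> \<O>" "absv b = 1 \<Longrightarrow> a / b \<in> \<O>"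
  using assms abs_ultrametric[of a b] absv_diff[of a b]
  by (auto simp: integer_ring_iff field_mem abs_mult absv_divide abs_nonneg mult_le_one)

lemma finite_residue_system:
  obtains R where "finite R" "R \<subseteq> \<O>" "\<And>x. x \<in> \<O> \<Longrightarrow> \<exists>r\<in>R. absv (x - r) < 1"
proof -
  define E where "E = {(x, y). x \<in> \<O> \<and> y \<in> \<O> \<and> absv (x - y) < 1}"
  define R where "R = (\<lambda>X. SOME x. x \<in> X) ` (\<O> // E)"
  have some: "(SOME y. y \<in> E `` {x}) \<in> E `` {x}" if "x \<in> \<O>" for x
  proof (rule someI)
    show "x \<in> E `` {x}" using that by (simp add: E_def)
  qed
  \<comment> \<open>The residue field is not infinite: otherwise the normalisation would say \<open>\<bar>unif\<bar> = 0\<close>.\<close>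
  have "card (\<O> // E) \<noteq> 0"
    using residue_size_gt_1 by (auto simp: residue_size_def residue_card_def E_def)
  then have "finite (\<O> // E)" by (metis card.infinite)
  then have "finite R" by (simp add: R_def)
  moreover have "R \<subseteq> \<O>" using some by (fastforce simp: R_def quotient_def E_def)
  moreover have "\<exists>r\<in>R. absv (x - r) < 1" if "x \<in> \<O>" for x
  proof
    show "absv (x - (SOME y. y \<in> E `` {x})) < 1" using some[OF that] by (auto simp: E_def)
    show "(SOME y. y \<in> E `` {x}) \<in> R" unfolding R_def by (intro imageI quotientI that)
  qed
  ultimately show ?thesis by (rule that)
qed

text \<open>
  The residue field of the algebraically closed field has an element outside the finite residue
  field of \<open>K\<close>. If \<open>R\<close> is a residue system of \<open>K\<close>, any root of \<open>\<Prod>r\<in>R. (X - r) = 1\<close> reduces to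
  such an element.
\<close>

lemma exists_generic_unit: "\<exists>z. absv z \<le> 1 \<and> (\<forall>a\<in>\<O>. absv (a - z) = 1)"
proof -
  obtain R where R: "finite R" "R \<subseteq> \<O>" "\<And>x. x \<in> \<O> \<Longrightarrow> \<exists>r\<in>R. absv (x - r) < 1"
    using finite_residue_system by blast
  have "R \<noteq> {}" using R(3)[of 0] zero_mem by (auto simp: integer_ring_iff)
  define P where "P = (\<Prod>r\<in>R. [:- r, 1:])"
  have "degree P = card R" unfolding P_def by (subst degree_prod_eq_sum_degree) auto
  then have "degree (P - 1) > 0"
    using R(1) \<open>R \<noteq> {}\<close> degree_add_eq_left[of "-1" P] by (simp add: card_gt_0_iff)
  then obtain z where "poly (P - 1) z = 0" using alg_closed_imp_poly_has_root by blast
  then have prod: "(\<Prod>r\<in>R. z - r) = 1" by (simp add: P_def poly_prod)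
  then have prod': "(\<Prod>r\<in>R. absv (z - r)) = 1" using absv_prod[of "\<lambda>r. z - r" R] by simp
  have z: "absv z \<le> 1"
  proof (rule ccontr)
    assume *: "\<not> absv z \<le> 1"
    have "absv (z - r) = absv z" if "r \<in> R" for r
      using * that R(2) by (intro absv_diff_eq_left) (auto simp: integer_ring_iff)
    then have "(\<Prod>r\<in>R. absv (z - r)) = absv z ^ card R" by simp
    moreover have "absv z ^ card R > 1" using * R(1) \<open>R \<noteq> {}\<close> by (simp add: card_gt_0_iff)
    ultimately show False using prod' by simp
  qed
  have le: "absv (z - r) \<le> 1" if "r \<in> \<O>" for r
    using absv_diff[of z r] z that by (auto simp: integer_ring_iff)
  have eq: "absv (z - r) = 1" if "r \<in> R" for r
  proof -
    have "1 = absv (z - r) * (\<Prod>s\<in>R - {r}. absv (z - s))"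
      using prod' R(1) that by (simp add: prod.remove)
    also have "\<dots> \<le> absv (z - r) * 1"
      using le R(2) by (intro mult_left_mono prod_le_1) (auto simp: abs_nonneg)
    finally show ?thesis using le[of r] R(2) that by auto
  qed
  have "absv (a - z) = 1" if a: "a \<in> \<O>" for a
  proof -
    obtain r where r: "r \<in> R" "absv (a - r) < 1" using R(3)[OF a] by blast
    then have "absv ((a - r) - (z - r)) = absv (z - r)" using eq by (intro absv_diff_eq_right) auto
    then show ?thesis using eq r by simp
  qed
  then show ?thesis using z by blast
qed


section \<open>Lattices and their norms\<close>

lemma K2_iff: "w \<in> K2 K \<longleftrightarrow> w $ 1 \<in> K \<and> w $ 2 \<in> K"
  by (simp add: K2_def forall_2)

lemma hcoord_K2: "x \<in> P1 K \<Longrightarrow> hcoord x \<in> K2 K"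
  by (auto simp: P1_def K2_iff field_mem)

lemma hcoord_nonzero: "hcoord x \<noteq> 0"
  by (cases x) (auto simp: vec_eq_iff forall_2)

lemma wedge_mem: "v \<in> K2 K \<Longrightarrow> w \<in> K2 K \<Longrightarrow> wedge v w \<in> K"
  by (simp add: K2_iff wedge_def field_mem)

lemma K2_scale: "c \<in> K \<Longrightarrow> v \<in> K2 K \<Longrightarrow> c *s v \<in> K2 K"
  by (simp add: K2_iff field_mem)

lemma K2_add: "v \<in> K2 K \<Longrightarrow> w \<in> K2 K \<Longrightarrow> v + w \<in> K2 K"
  by (simp add: K2_iff field_mem)

definition basis :: "'c ^ 2 \<Rightarrow> 'c ^ 2 \<Rightarrow> bool" where
  "basis v w \<longleftrightarrow> v \<in> K2 K \<and> w \<in> K2 K \<and> wedge v w \<noteq> 0"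

definition lattice_span :: "'c ^ 2 \<Rightarrow> 'c ^ 2 \<Rightarrow> ('c ^ 2) set" where
  "lattice_span v w = {a *s v + b *s w | a b. a \<in> \<O> \<and> b \<in> \<O>}"

lemma lattices_eq: "lattices absv K = {lattice_span v w | v w. basis v w}"
  by (simp add: lattices_def lattice_span_def basis_def)

lemma basis_coordinates:
  assumes "basis v w" "x \<in> K2 K"
  obtains a b where "a \<in> K" "b \<in> K" "x = a *s v + b *s w"
proof
  let ?a = "wedge x w / wedge v w" and ?b = "wedge v x / wedge v w"
  show "?a \<in> K" "?b \<in> K" using assms by (auto simp: basis_def intro!: wedge_mem divide_mem)
  have "wedge v w \<noteq> 0" using assms by (simp add: basis_def)
  moreover have "wedge v w * x $ i = wedge x w * v $ i + wedge v x * w $ i" for i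
    using exhaust_2[of i] by (auto simp: wedge_def algebra_simps)
  ultimately show "x = ?a *s v + ?b *s w"
    by (simp add: vec_eq_iff divide_simps) (simp add: algebra_simps)
qed

lemma basis_coordinates_unique:
  assumes "basis v w" "a *s v + b *s w = a' *s v + b' *s w"
  shows "a = a'" "b = b'"
proof -
  have wedge: "wedge (a *s v + b *s w) w = a * wedge v w" "wedge v (a *s v + b *s w) = b * wedge v w" for a b
    by (auto simp: wedge_def algebra_simps)
  have "a * wedge v w = a' * wedge v w" "b * wedge v w = b' * wedge v w"
    using assms(2) by (metis wedge(1), metis wedge(2))
  then show "a = a'" "b = b'" using assms(1) by (auto simp: basis_def)
qed

lemma lattice_norm_span:
  assumes "basis v w" "a \<in> K" "b \<in> K"
  shows "lattice_norm absv K (lattice_span v w) (a *s v + b *s w) = max (absv a) (absv b)"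
proof -
  have mem: "a *s v + b *s w \<in> (*s) c ` lattice_span v w \<longleftrightarrow> max (absv a) (absv b) \<le> absv c"
    if "c \<in> K" for c
  proof
    assume "a *s v + b *s w \<in> (*s) c ` lattice_span v w"
    then obtain a' b' where ab: "a' \<in> \<O>" "b' \<in> \<O>" "a *s v + b *s w = c *s (a' *s v + b' *s w)"
      unfolding lattice_span_def by blast
    then have "a *s v + b *s w = (c * a') *s v + (c * b') *s w"
      by (simp add: vector_add_ldistrib vector_smult_assoc)
    then have "a = c * a'" "b = c * b'" using basis_coordinates_unique[OF assms(1)] by auto
    then show "max (absv a) (absv b) \<le> absv c"
      using ab by (auto simp: integer_ring_iff abs_mult abs_nonneg intro!: mult_right_le_one_le)
  next
    assume le: "max (absv a) (absv b) \<le> absv c"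
    show "a *s v + b *s w \<in> (*s) c ` lattice_span v w"
    proof (cases "c = 0")
      case True
      then have "absv a = 0" "absv b = 0" using le abs_nonneg[of a] abs_nonneg[of b] by auto
      then have "a *s v + b *s w = 0 *s (0 *s v + 0 *s w)" by (simp add: abs_zero_iff)
      then show ?thesis unfolding True lattice_span_def
        by (intro image_eqI) (auto simp: integer_ring_iff zero_mem intro!: exI[of _ 0])
    next
      case False
      then have "a *s v + b *s w = c *s ((a / c) *s v + (b / c) *s w)"
        by (simp add: vector_add_ldistrib vector_smult_assoc)
      moreover have "a / c \<in> \<O>" "b / c \<in> \<O>"
        using le False assms that by (auto simp: integer_ring_iff absv_divide divide_mem)
      ultimately show ?thesis unfolding lattice_span_def by blast
    qed
  qed
  have "lattice_norm absv K (lattice_span v w) (a *s v + b *s w)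
      = Inf {absv c | c. c \<in> K \<and> max (absv a) (absv b) \<le> absv c}"
    unfolding lattice_norm_def using mem by (metis (no_types, lifting))
  also have "\<dots> = max (absv a) (absv b)"
    using assms by (intro cInf_eq_minimum) (auto simp: max_def)
  finally show ?thesis .
qed

lemma lattice_span_sub_K2: "basis v w \<Longrightarrow> lattice_span v w \<subseteq> K2 K"
  by (auto simp: lattice_span_def basis_def integer_ring_iff intro!: K2_add K2_scale)

lemma lattice_sub_K2: "M \<in> lattices absv K \<Longrightarrow> M \<subseteq> K2 K"
  using lattice_span_sub_K2 by (auto simp: lattices_eq)

text \<open>
  A lattice is the unit ball of its norm. Through this, inclusions between lattices and their
  multiples become inequalities between norms.
\<close>

lemma mem_lattice_iff:
  assumes "M \<in> lattices absv K" "x \<in> K2 K"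
  shows "x \<in> M \<longleftrightarrow> lattice_norm absv K M x \<le> 1"
proof -
  obtain v w where M: "basis v w" "M = lattice_span v w" using assms by (auto simp: lattices_eq)
  obtain a b where ab: "a \<in> K" "b \<in> K" "x = a *s v + b *s w" using basis_coordinates M assms by blast
  have "x \<in> M \<longleftrightarrow> a \<in> \<O> \<and> b \<in> \<O>"
    unfolding ab M(2) lattice_span_def using basis_coordinates_unique[OF M(1)] by blast
  then show ?thesis using lattice_norm_span[OF M(1) ab(1,2)] ab M by (simp add: integer_ring_iff)
qed

lemma lattice_norm_in_value_group:
  assumes "M \<in> lattices absv K" "x \<in> K2 K" "x \<noteq> 0"
  shows "lattice_norm absv K M x \<in> value_group"
proof -
  obtain v w where M: "basis v w" "M = lattice_span v w" using assms by (auto simp: lattices_eq)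
  obtain a b where ab: "a \<in> K" "b \<in> K" "x = a *s v + b *s w" using basis_coordinates M assms by blast
  have "max (absv a) (absv b) = absv a \<and> a \<noteq> 0 \<or> max (absv a) (absv b) = absv b \<and> b \<noteq> 0"
    using ab assms(3) abs_nonneg[of a] abs_nonneg[of b] absv_pos_iff[of a] absv_pos_iff[of b]
    by (cases "a = 0"; cases "b = 0") (auto simp: max_def)
  then show ?thesis
    using absv_in_value_group ab lattice_norm_span[OF M(1) ab(1,2)] M by metis
qed

lemma lattice_norm_pos:
  "M \<in> lattices absv K \<Longrightarrow> x \<in> K2 K \<Longrightarrow> x \<noteq> 0 \<Longrightarrow> 0 < lattice_norm absv K M x"
  by (rule value_group_pos[OF lattice_norm_in_value_group])

lemma lattice_norm_scale:
  assumes "M \<in> lattices absv K" "x \<in> K2 K" "c \<in> K"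
  shows "lattice_norm absv K M (c *s x) = absv c * lattice_norm absv K M x"
proof -
  obtain v w where M: "basis v w" "M = lattice_span v w" using assms by (auto simp: lattices_eq)
  obtain a b where ab: "a \<in> K" "b \<in> K" "x = a *s v + b *s w" using basis_coordinates M assms by blast
  have "c *s x = (c * a) *s v + (c * b) *s w"
    by (simp add: ab vector_add_ldistrib vector_smult_assoc)
  then show ?thesis using lattice_norm_span[OF M(1)] ab assms M
    by (simp add: mult_mem abs_mult max_mult_distrib_left abs_nonneg)
qed

lemma scale_lattice:
  assumes "M \<in> lattices absv K" "c \<in> K" "c \<noteq> 0"
  shows "(*s) c ` M \<in> lattices absv K"
    and "x \<in> K2 K \<Longrightarrow> lattice_norm absv K ((*s) c ` M) x = lattice_norm absv K M x / absv c"
proof -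
  obtain v w where M: "basis v w" "M = lattice_span v w" using assms by (auto simp: lattices_eq)
  have b: "basis (c *s v) (c *s w)"
    using M(1) assms by (auto simp: basis_def K2_scale wedge_def algebra_simps)
  have "(*s) c ` M = {c *s (a *s v + b *s w) | a b. a \<in> \<O> \<and> b \<in> \<O>}"
    unfolding M(2) lattice_span_def by blast
  moreover have "c *s (a *s v + b *s w) = a *s (c *s v) + b *s (c *s w)" for a b
    by (simp add: vector_add_ldistrib vector_smult_assoc mult.commute)
  ultimately have span: "(*s) c ` M = lattice_span (c *s v) (c *s w)"
    by (simp only: lattice_span_def)
  then show "(*s) c ` M \<in> lattices absv K" using b by (auto simp: lattices_eq)
  show "lattice_norm absv K ((*s) c ` M) x = lattice_norm absv K M x / absv c" if x: "x \<in> K2 K"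
  proof -
    obtain a b where ab: "a \<in> K" "b \<in> K" "x = a *s v + b *s w"
      using basis_coordinates[OF M(1) x] .
    have "x = (a / c) *s (c *s v) + (b / c) *s (c *s w)"
      using assms by (simp add: ab vector_smult_assoc)
    then show ?thesis
      using lattice_norm_span[OF b, of "a / c" "b / c"] lattice_norm_span[OF M(1) ab(1,2)] ab assms
      unfolding span unfolding M(2)
      by (simp add: divide_mem absv_divide max_divide_distrib_right abs_nonneg)
  qed
qed

lemma mem_scale_lattice_iff:
  assumes "M \<in> lattices absv K" "c \<in> K" "c \<noteq> 0" "x \<in> K2 K"
  shows "x \<in> (*s) c ` M \<longleftrightarrow> lattice_norm absv K M x \<le> absv c"
  using mem_lattice_iff[OF scale_lattice(1)] scale_lattice(2) assms by (simp add: divide_le_eq)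

lemma scale_lattice_mono:
  assumes "M \<in> lattices absv K" "c \<in> K" "c \<noteq> 0" "d \<in> K" "d \<noteq> 0" "absv c \<le> absv d"
  shows "(*s) c ` M \<subseteq> (*s) d ` M"
proof
  fix x assume x: "x \<in> (*s) c ` M"
  then have "x \<in> K2 K" using lattice_sub_K2[OF scale_lattice(1)[OF assms(1-3)]] by blast
  then show "x \<in> (*s) d ` M"
    using x assms mem_scale_lattice_iff[OF assms(1-3)] mem_scale_lattice_iff[OF assms(1,4,5)] by simp
qed

lemma scale_lattice_cong:
  assumes "M \<in> lattices absv K" "c \<in> K" "c \<noteq> 0" "d \<in> K" "d \<noteq> 0" "absv c = absv d"
  shows "(*s) c ` M = (*s) d ` M"
  using assms by (intro antisym scale_lattice_mono) auto

lemma scale_scale: "(*s) c ` (*s) d ` M = (*s) (c * d) ` (M :: ('c ^ 2) set)"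
  by (simp add: image_image vector_smult_assoc)

lemma sup_norm_add: "sup_norm (v + w) \<le> max (sup_norm v) (sup_norm w)"
  using abs_ultrametric[of "v $ 1" "w $ 1"] abs_ultrametric[of "v $ 2" "w $ 2"]
  by (auto simp: sup_norm_def)

lemma sup_norm_scale: "sup_norm (c *s v) = absv c * sup_norm v"
  by (simp add: sup_norm_def abs_mult max_mult_distrib_left abs_nonneg)

lemma sup_norm_nonneg: "0 \<le> sup_norm v"
  using abs_nonneg[of "v $ 1"] by (simp add: sup_norm_def le_max_iff_disj)

lemma sup_norm_le_lattice_norm:
  assumes "M \<in> lattices absv K"
  shows "\<exists>C>0. \<forall>x\<in>K2 K. sup_norm x \<le> C * lattice_norm absv K M x"
proof -
  obtain v w where M: "basis v w" "M = lattice_span v w" using assms by (auto simp: lattices_eq)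
  let ?C = "max 1 (max (sup_norm v) (sup_norm w))"
  have "sup_norm x \<le> ?C * lattice_norm absv K M x" if x: "x \<in> K2 K" for x
  proof -
    obtain a b where ab: "a \<in> K" "b \<in> K" "x = a *s v + b *s w" using basis_coordinates[OF M(1) x] .
    have "sup_norm (a *s v) \<le> max (absv a) (absv b) * ?C"
      "sup_norm (b *s w) \<le> max (absv a) (absv b) * ?C"
      unfolding sup_norm_scale by (intro mult_mono; auto simp: abs_nonneg sup_norm_nonneg le_max_iff_disj)+
    then have "sup_norm x \<le> max (absv a) (absv b) * ?C"
      unfolding ab using sup_norm_add[of "a *s v" "b *s w"] by linarith
    then show ?thesis using lattice_norm_span[OF M(1) ab(1,2)] M ab by (simp add: mult.commute)
  qed
  then show ?thesis by (intro exI[of _ ?C]) auto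
qed

text \<open>A vector of norm 1 is primitive, so that it is part of a basis of the lattice.\<close>

lemma complete_to_basis:
  assumes "M \<in> lattices absv K" "x \<in> K2 K" "lattice_norm absv K M x = 1"
  obtains y where "basis x y" "M = lattice_span x y"
proof -
  have half: "\<exists>y. basis x y \<and> M = lattice_span x y"
    if M: "basis v w" "M = lattice_span v w" and ab: "a \<in> \<O>" "b \<in> \<O>" "x = a *s v + b *s w"
      and a: "absv a = 1" for v w a b
  proof -
    have a0: "a \<noteq> 0" using a by auto
    have "wedge x w = a * wedge v w" by (simp add: ab wedge_def algebra_simps)
    then have b: "basis x w" using M(1) a0 assms(2) by (simp add: basis_def)
    have "lattice_span x w = lattice_span v w"
    proof (intro antisym subsetI)
      fix s assume "s \<in> lattice_span x w"
      then obtain c d where cd: "c \<in> \<O>" "d \<in> \<O>" "s = c *s x + d *s w" by (auto simp: lattice_span_def)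
      have "s = (c * a) *s v + (c * b + d) *s w"
        by (simp add: cd ab vec_eq_iff algebra_simps)
      moreover have "c * a \<in> \<O>" "c * b + d \<in> \<O>"
        using cd ab by (auto intro: integer_ring_closed)
      ultimately show "s \<in> lattice_span v w" unfolding lattice_span_def by blast
    next
      fix s assume "s \<in> lattice_span v w"
      then obtain c d where cd: "c \<in> \<O>" "d \<in> \<O>" "s = c *s v + d *s w" by (auto simp: lattice_span_def)
      have "s = (c / a) *s x + (d - c / a * b) *s w"
        using a0 by (simp add: cd ab vec_eq_iff field_simps)
      moreover have "c / a \<in> \<O>" "d - c / a * b \<in> \<O>"
        using cd ab a integer_ring_closed(2)[of d "c / a * b"] integer_ring_closed(3)[of "c / a" b]
          integer_ring_closed(4)[of c a] by auto
      ultimately show "s \<in> lattice_span x w" unfolding lattice_span_def by blast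
    qed
    then show ?thesis using b M by auto
  qed
  obtain v w where M: "basis v w" "M = lattice_span v w" using assms by (auto simp: lattices_eq)
  obtain a b where ab: "a \<in> K" "b \<in> K" "x = a *s v + b *s w" using basis_coordinates M assms by blast
  have max: "max (absv a) (absv b) = 1" using lattice_norm_span[OF M(1) ab(1,2)] assms(3) M ab by simp
  then have O: "a \<in> \<O>" "b \<in> \<O>" using ab by (auto simp: integer_ring_iff max_def split: if_splits)
  consider "absv a = 1" | "absv b = 1" using max by (auto simp: max_def split: if_splits)
  then have "\<exists>y. basis x y \<and> M = lattice_span x y"
  proof cases
    case 1
    then show ?thesis using half[OF M O] ab by blast
  next
    case 2
    have "wedge w v = - wedge v w" by (simp add: wedge_def algebra_simps)
    then have "basis w v" using M(1) by (auto simp: basis_def)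
    moreover have "M = lattice_span w v"
    proof -
      have "lattice_span v w \<subseteq> lattice_span w v" for v w
      proof
        fix s assume "s \<in> lattice_span v w"
        then obtain c d where cd: "c \<in> \<O>" "d \<in> \<O>" "s = c *s v + d *s w"
          unfolding lattice_span_def by blast
        have "s = d *s w + c *s v" unfolding cd by (rule add.commute)
        with cd show "s \<in> lattice_span w v" unfolding lattice_span_def by blast
      qed
      then show ?thesis unfolding M by blast
    qed
    moreover have "x = b *s w + a *s v" unfolding ab by (rule add.commute)
    ultimately show ?thesis using half[of w v b a] O 2 by blast
  qed
  then show ?thesis using that by blast
qed

lemma lattice_norm_less_1:
  assumes "M \<in> lattices absv K" "x \<in> K2 K" "lattice_norm absv K M x < 1"
  shows "lattice_norm absv K M x \<le> absv unif"
proof (cases "x = 0")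
  case True
  then show ?thesis using lattice_norm_scale[OF assms(1,2), of 0] zero_mem abs_nonneg by simp
next
  case False
  have "1 \<in> value_group" using absv_in_value_group[OF one_mem] by simp
  then have "residue_size * lattice_norm absv K M x \<le> 1"
    using value_group_gap lattice_norm_in_value_group[OF assms(1,2) False] assms(3) by blast
  then show ?thesis using residue_size_gt_1 by (simp add: unif(2) field_simps)
qed

lemma lattice_combination:
  assumes "M \<in> lattices absv K" "x \<in> M" "y \<in> M" "a \<in> \<O>" "b \<in> \<O>"
  shows "a *s x + b *s y \<in> M"
proof -
  obtain v w where M: "M = lattice_span v w" using assms by (auto simp: lattices_eq)
  obtain c d where cd: "c \<in> \<O>" "d \<in> \<O>" "x = c *s v + d *s w" using assms M unfolding lattice_span_def by blast
  obtain c' d' where cd': "c' \<in> \<O>" "d' \<in> \<O>" "y = c' *s v + d' *s w" using assms M unfolding lattice_span_def by blast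
  have "a *s x + b *s y = (a * c + b * c') *s v + (a * d + b * d') *s w"
    unfolding cd cd' by (simp add: vec_eq_iff algebra_simps)
  moreover have "a * c + b * c' \<in> \<O>" "a * d + b * d' \<in> \<O>"
    using assms cd cd' by (auto intro!: integer_ring_closed)
  ultimately show ?thesis unfolding M lattice_span_def by blast
qed

lemma vertex_elem:
  assumes "x \<in> bt_vertices absv K" "M \<in> x"
  shows "M \<in> lattices absv K" "x = lattice_class K M"
proof -
  obtain M0 where M0: "M0 \<in> lattices absv K" "x = lattice_class K M0"
    using assms(1) by (auto simp: bt_vertices_def)
  obtain c where c: "c \<in> K" "c \<noteq> 0" "M = (*s) c ` M0" using assms(2) M0 by (auto simp: lattice_class_def)
  show "M \<in> lattices absv K" using scale_lattice(1)[OF M0(1)] c by simp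
  have "(*s) d ` M0 = (*s) (d / c) ` M" for d using c by (simp add: scale_scale)
  moreover have "(*s) d ` M = (*s) (d * c) ` M0" for d using c by (simp add: scale_scale)
  ultimately show "x = lattice_class K M"
    unfolding M0 lattice_class_def using c
    by (safe; metis divide_mem mult_mem divide_eq_0_iff mult_eq_0_iff)
qed

lemma scale_one: "(*s) 1 ` M = (M :: ('c ^ 2) set)"
  by (simp add: image_def)

lemma lattice_class_self: "M \<in> lattice_class K M"
  unfolding lattice_class_def using one_mem scale_one[of M] by (auto intro!: exI[of _ 1])

lemma vertex_nonempty: "x \<in> bt_vertices absv K \<Longrightarrow> \<exists>M. M \<in> x"
  using lattice_class_self by (auto simp: bt_vertices_def)

lemma vertex_lattices_proportional:
  assumes "x \<in> bt_vertices absv K" "M \<in> x" "N \<in> x"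
  obtains c where "c \<in> K" "c \<noteq> 0" "N = (*s) c ` M"
  using vertex_elem[OF assms(1,2)] assms(3) by (auto simp: lattice_class_def)

lemma vertex_scale:
  assumes "x \<in> bt_vertices absv K" "M \<in> x" "c \<in> K" "c \<noteq> 0"
  shows "(*s) c ` M \<in> x"
  using vertex_elem[OF assms(1,2)] assms(3,4) by (auto simp: lattice_class_def)


section \<open>Fibres of the map to the tree\<close>

lemma norm_class_eq_iff:
  "norm_class K \<alpha> = norm_class K \<beta> \<longleftrightarrow> (\<exists>t>0. \<forall>w\<in>K2 K. \<alpha> w = t * \<beta> w)"
proof
  assume "norm_class K \<alpha> = norm_class K \<beta>"
  moreover have "\<alpha> \<in> norm_class K \<alpha>" unfolding norm_class_def by (auto intro!: exI[of _ 1])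
  ultimately show "\<exists>t>0. \<forall>w\<in>K2 K. \<alpha> w = t * \<beta> w" by (simp add: norm_class_def)
next
  assume "\<exists>t>0. \<forall>w\<in>K2 K. \<alpha> w = t * \<beta> w"
  then obtain t where t: "t > 0" "\<And>w. w \<in> K2 K \<Longrightarrow> \<alpha> w = t * \<beta> w" by blast
  show "norm_class K \<alpha> = norm_class K \<beta>"
  proof (intro antisym subsetI)
    fix \<gamma> assume "\<gamma> \<in> norm_class K \<alpha>"
    then obtain s where s: "s > 0" "\<And>w. w \<in> K2 K \<Longrightarrow> \<gamma> w = s * \<alpha> w" by (auto simp: norm_class_def)
    have "\<gamma> w = (s * t) * \<beta> w" if "w \<in> K2 K" for w using s(2) t(2) that by simp
    then show "\<gamma> \<in> norm_class K \<beta>" unfolding norm_class_def using s(1) t(1) mult_pos_pos by blast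
  next
    fix \<gamma> assume "\<gamma> \<in> norm_class K \<beta>"
    then obtain s where s: "s > 0" "\<And>w. w \<in> K2 K \<Longrightarrow> \<gamma> w = s * \<beta> w" by (auto simp: norm_class_def)
    have "\<gamma> w = (s / t) * \<alpha> w" if "w \<in> K2 K" for w using s(2) t that by simp
    then show "\<gamma> \<in> norm_class K \<alpha>" unfolding norm_class_def using s(1) t(1) divide_pos_pos by blast
  qed
qed

text \<open>
  The norm class attached to a vertex is that of an arbitrarily chosen lattice of the vertex. Any
  other one differs from it by a scalar, which the factor \<open>t\<close> absorbs.
\<close>

lemma mem_drinfeld_fibre_iff:
  assumes "x \<in> bt_vertices absv K" "M \<in> x"
  shows "z \<in> drinfeld_fibre absv K x \<longleftrightarrow>
    (\<exists>t>0. \<forall>w\<in>K2 K. absv (wedge w (hcoord z)) = t * lattice_norm absv K M w)"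
proof -
  let ?\<phi> = "\<lambda>w. absv (wedge w (hcoord z))"
  define M' where "M' = (SOME M. M \<in> x)"
  have M': "M' \<in> x" using assms(2) unfolding M'_def by (rule someI)
  note lat = vertex_elem(1)[OF assms] vertex_elem(1)[OF assms(1) M']
  obtain c where c: "c \<in> K" "c \<noteq> 0" "M = (*s) c ` M'"
    using vertex_lattices_proportional[OF assms(1) M' assms(2)] .
  have c0: "absv c \<noteq> 0" using c(2) abs_zero_iff by simp
  have norm: "lattice_norm absv K M w = lattice_norm absv K M' w / absv c" if "w \<in> K2 K" for w
    using scale_lattice(2)[OF lat(2) c(1,2) that] c(3) by simp
  have scale: "(\<exists>t>0. \<forall>w\<in>K2 K. ?\<phi> w = t * lattice_norm absv K M' w)
      \<longleftrightarrow> (\<exists>t>0. \<forall>w\<in>K2 K. ?\<phi> w = t * lattice_norm absv K M w)"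
  proof
    assume "\<exists>t>0. \<forall>w\<in>K2 K. ?\<phi> w = t * lattice_norm absv K M' w"
    then obtain t where "t > 0" "\<forall>w\<in>K2 K. ?\<phi> w = t * lattice_norm absv K M' w" by blast
    then show "\<exists>t>0. \<forall>w\<in>K2 K. ?\<phi> w = t * lattice_norm absv K M w"
      using norm c0 absv_pos_iff[of c] c(2) by (intro exI[of _ "t * absv c"]) simp
  next
    assume "\<exists>t>0. \<forall>w\<in>K2 K. ?\<phi> w = t * lattice_norm absv K M w"
    then obtain t where "t > 0" "\<forall>w\<in>K2 K. ?\<phi> w = t * lattice_norm absv K M w" by blast
    then show "\<exists>t>0. \<forall>w\<in>K2 K. ?\<phi> w = t * lattice_norm absv K M' w"
      using norm c0 absv_pos_iff[of c] c(2) by (intro exI[of _ "t / absv c"]) simp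
  qed
  \<comment> \<open>The functional of a rational point vanishes at a nonzero rational vector; no norm does.\<close>
  have "z \<notin> P1 K" if t: "t > 0" "\<forall>w\<in>K2 K. ?\<phi> w = t * lattice_norm absv K M w" for t
  proof
    assume "z \<in> P1 K"
    then have z: "hcoord z \<in> K2 K" by (rule hcoord_K2)
    then have "0 < t * lattice_norm absv K M (hcoord z)"
      using t lattice_norm_pos[OF lat(1) z hcoord_nonzero] by simp
    moreover have "?\<phi> (hcoord z) = 0" by (simp add: wedge_def mult.commute)
    ultimately show False using t(2) z by (metis less_irrefl)
  qed
  then show ?thesis
    by (simp only: drinfeld_fibre_def drinfeld_map_def vertex_point_def M'_def[symmetric]
        norm_class_eq_iff scale mem_Collect_eq) blast
qed

text \<open>
  For a basis \<open>v\<close>, \<open>w\<close> of the lattice, the point \<open>\<zeta> v + w\<close> with \<open>\<zeta>\<close> generic modulo the maximal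
  ideal lies in the fibre.
\<close>

lemma drinfeld_fibre_nonempty:
  assumes "x \<in> bt_vertices absv K"
  shows "drinfeld_fibre absv K x \<noteq> {}"
proof -
  obtain M where M: "M \<in> x" using vertex_nonempty[OF assms] by blast
  obtain v w where vw: "basis v w" "M = lattice_span v w"
    using vertex_elem(1)[OF assms M] by (auto simp: lattices_eq)
  obtain \<zeta> where \<zeta>: "absv \<zeta> \<le> 1" "\<And>a. a \<in> \<O> \<Longrightarrow> absv (a - \<zeta>) = 1"
    using exists_generic_unit by blast
  have gen: "absv (a - b * \<zeta>) = max (absv a) (absv b)" if ab: "a \<in> K" "b \<in> K" for a b
  proof (cases "absv a \<le> absv b")
    case True
    show ?thesis
    proof (cases "b = 0")
      case True
      then show ?thesis by (simp add: abs_nonneg)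
    next
      case False
      then have "a / b \<in> \<O>" using True ab by (simp add: integer_ring_iff absv_divide divide_mem)
      then have "absv (b * (a / b - \<zeta>)) = absv b" using \<zeta>(2) by (simp add: abs_mult)
      then show ?thesis using True False by (simp add: algebra_simps)
    qed
  next
    case False
    have "absv (b * \<zeta>) \<le> absv b" using \<zeta>(1) by (simp add: abs_mult abs_nonneg mult_left_le)
    then show ?thesis using False by (simp add: absv_diff_eq_left)
  qed
  define u where "u = \<zeta> *s v + w"
  have wedge_u: "wedge (a *s v + b *s w) u = (a - b * \<zeta>) * wedge v w" for a b
    by (simp add: u_def wedge_def algebra_simps)
  have wv: "wedge v w \<noteq> 0" using vw(1) by (simp add: basis_def)
  have "u \<noteq> 0"
  proof
    assume "u = 0"
    then have "(1 - 0 * \<zeta>) * wedge v w = 0" using wedge_u[of 1 0] by (simp add: wedge_def)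
    then show False using wv by simp
  qed
  define s where "s = (if u $ 2 = 0 then u $ 1 else u $ 2)"
  have s: "s \<noteq> 0" using \<open>u \<noteq> 0\<close> by (auto simp: s_def vec_eq_iff forall_2)
  have u: "u = s *s hcoord (proj_point u)"
    by (auto simp: s_def proj_point_def vec_eq_iff forall_2)
  have "absv (wedge y (hcoord (proj_point u))) = absv (wedge v w) / absv s * lattice_norm absv K M y"
    if y: "y \<in> K2 K" for y
  proof -
    obtain a b where ab: "a \<in> K" "b \<in> K" "y = a *s v + b *s w" using basis_coordinates[OF vw(1) y] .
    have "wedge y u = s * wedge y (hcoord (proj_point u))"
      by (subst u) (simp add: wedge_def algebra_simps)
    then have "absv s * absv (wedge y (hcoord (proj_point u))) = absv (wedge y u)"
      by (simp add: abs_mult)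
    also have "\<dots> = max (absv a) (absv b) * absv (wedge v w)"
      unfolding ab(3) wedge_u abs_mult gen[OF ab(1,2)] ..
    finally have "absv s * absv (wedge y (hcoord (proj_point u))) = max (absv a) (absv b) * absv (wedge v w)" .
    moreover have "absv s \<noteq> 0" using s abs_zero_iff by simp
    ultimately show ?thesis
      using lattice_norm_span[OF vw(1) ab(1,2)] by (simp add: ab(3) vw(2) field_simps)
  qed
  then have "proj_point u \<in> drinfeld_fibre absv K x"
    unfolding mem_drinfeld_fibre_iff[OF assms M] using s wv
    by (intro exI[of _ "absv (wedge v w) / absv s"]) auto
  then show ?thesis by blast
qed

lemma chordal_on_fibre:
  assumes "v \<in> bt_vertices absv K" "M \<in> v" "z \<in> drinfeld_fibre absv K v"
  shows "\<exists>t>0. \<forall>x\<in>P1 K. chordal absv x z = t * (lattice_norm absv K M (hcoord x) / sup_norm (hcoord x))"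
proof -
  obtain t where t: "t > 0" "\<forall>w\<in>K2 K. absv (wedge w (hcoord z)) = t * lattice_norm absv K M w"
    using assms mem_drinfeld_fibre_iff by blast
  show ?thesis
    using t sup_norm_hcoord_pos[of z] hcoord_K2
    by (intro exI[of _ "t / sup_norm (hcoord z)"]) (auto simp: chordal_eq)
qed

text \<open>
  The chordal distance from a rational point to a point of the fibre is bounded below because the
  lattice norm is bounded below by a multiple of the sup-norm.
\<close>

lemma fibre_sub_affinoid:
  assumes "v \<in> bt_vertices absv K" "L \<subseteq> P1 K"
  shows "\<exists>\<epsilon>>0. drinfeld_fibre absv K v \<subseteq> affinoid absv L \<epsilon>"
proof -
  obtain M where M: "M \<in> v" using vertex_nonempty[OF assms(1)] by blast
  note lat = vertex_elem(1)[OF assms(1) M]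
  obtain C where C: "C > 0" "\<And>x. x \<in> K2 K \<Longrightarrow> sup_norm x \<le> C * lattice_norm absv K M x"
    using sup_norm_le_lattice_norm[OF lat] by blast
  define e1 :: "'c ^ 2" where "e1 = hcoord Infinity"
  define e2 :: "'c ^ 2" where "e2 = hcoord (Affine 0)"
  have e: "e1 \<in> K2 K" "e2 \<in> K2 K" by (auto simp: e1_def e2_def K2_iff field_mem)
  define m where "m = max (lattice_norm absv K M e1) (lattice_norm absv K M e2)"
  have "e1 \<noteq> 0" unfolding e1_def by (rule hcoord_nonzero)
  then have m: "m > 0" using lattice_norm_pos[OF lat e(1)] by (simp add: m_def less_max_iff_disj)
  have "1 / (C * m) \<le> chordal absv z x" if z: "z \<in> drinfeld_fibre absv K v" and x: "x \<in> L" for z x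
  proof -
    obtain t where t: "t > 0" "\<And>w. w \<in> K2 K \<Longrightarrow> absv (wedge w (hcoord z)) = t * lattice_norm absv K M w"
      using z mem_drinfeld_fibre_iff[OF assms(1) M] by blast
    have "sup_norm (hcoord z) = max (absv (wedge e1 (hcoord z))) (absv (wedge e2 (hcoord z)))"
      by (simp add: sup_norm_def e1_def e2_def wedge_def max.commute)
    also have "\<dots> = t * m" using t e by (simp add: m_def max_mult_distrib_left)
    finally have sz: "sup_norm (hcoord z) = t * m" .
    have xK: "hcoord x \<in> K2 K" using x assms(2) by (auto intro: hcoord_K2)
    have "chordal absv z x = chordal absv x z" by (rule chordal_commute)
    also have "\<dots> = lattice_norm absv K M (hcoord x) / sup_norm (hcoord x) / m"
      using t m xK by (simp add: chordal_eq sz)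
    moreover have "1 / C \<le> lattice_norm absv K M (hcoord x) / sup_norm (hcoord x)"
      using C(2)[OF xK] C(1) sup_norm_hcoord_pos[of x] by (simp add: field_simps)
    ultimately show ?thesis
      using divide_right_mono[of "1 / C" "lattice_norm absv K M (hcoord x) / sup_norm (hcoord x)" m] m
      by simp
  qed
  then show ?thesis using C(1) m
    by (intro exI[of _ "1 / (C * m)"]) (auto simp: affinoid_def)
qed

lemma affinoid_antimono: "\<epsilon> \<le> \<delta> \<Longrightarrow> affinoid absv L \<delta> \<subseteq> affinoid absv L \<epsilon>"
  by (fastforce simp: affinoid_def)

lemma fibres_sub_affinoid:
  assumes "finite V" "V \<subseteq> bt_vertices absv K" "L \<subseteq> P1 K"
  shows "\<exists>\<epsilon>>0. \<forall>v\<in>V. drinfeld_fibre absv K v \<subseteq> affinoid absv L \<epsilon>"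
  using assms(1,2)
proof (induction V)
  case empty
  then show ?case by (auto intro: exI[of _ 1])
next
  case (insert v V)
  then obtain \<epsilon> \<delta> where "\<epsilon> > 0" "\<delta> > 0" "\<forall>v\<in>V. drinfeld_fibre absv K v \<subseteq> affinoid absv L \<epsilon>"
    "drinfeld_fibre absv K v \<subseteq> affinoid absv L \<delta>"
    using fibre_sub_affinoid[of v L] assms(3) by auto
  then show ?case
    using affinoid_antimono[of "min \<epsilon> \<delta>" \<epsilon> L] affinoid_antimono[of "min \<epsilon> \<delta>" \<delta> L]
    by (intro exI[of _ "min \<epsilon> \<delta>"]) auto
qed


section \<open>Neighbours of a vertex\<close>

definition neighbours :: "('c ^ 2) set \<Rightarrow> ('c ^ 2) set set" where
  "neighbours M = {N \<in> lattices absv K. (*s) unif ` M \<subset> N \<and> N \<subset> M}"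

text \<open>
  The norm of a neighbour lies between the norm of \<open>M\<close> and its \<open>q\<close>-fold, and no absolute value of
  \<open>K\<close> lies strictly between \<open>1\<close> and \<open>q\<close>.
\<close>

lemma neighbour_norm:
  assumes "M \<in> lattices absv K" "N \<in> neighbours M" "x \<in> K2 K" "lattice_norm absv K M x = 1"
  shows "lattice_norm absv K N x = (if x \<in> N then 1 else residue_size)"
proof -
  have N: "N \<in> lattices absv K" "(*s) unif ` M \<subseteq> N" "N \<subseteq> M"
    using assms(2) by (auto simp: neighbours_def)
  have x0: "x \<noteq> 0" using lattice_norm_scale[OF assms(1,3) zero_mem] assms(4) by auto
  note vg = lattice_norm_in_value_group[OF N(1) assms(3) x0]
  have vg1: "1 \<in> value_group" using absv_in_value_group[OF one_mem] by simp
  have "x \<in> M" using mem_lattice_iff assms by simp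
  then have "unif *s x \<in> N" using N(2) by blast
  then have "absv unif * lattice_norm absv K N x \<le> 1"
    using mem_lattice_iff[OF N(1)] lattice_norm_scale[OF N(1) assms(3) unif_mem] K2_scale assms(3) unif_mem by simp
  then have le: "lattice_norm absv K N x \<le> residue_size"
    using residue_size_gt_1 by (simp add: unif(2) field_simps)
  have ge: "1 \<le> lattice_norm absv K N x"
  proof (rule ccontr)
    assume less: "\<not> 1 \<le> lattice_norm absv K N x"
    then obtain c where c: "c \<in> K" "c \<noteq> 0" "absv c = lattice_norm absv K N x"
      using value_group_attained[OF vg] by blast
    have "x \<in> (*s) c ` N" using mem_scale_lattice_iff[OF N(1) c(1,2) assms(3)] c(3) by simp
    then have "x \<in> (*s) c ` M" using N(3) by blast
    then have "1 \<le> absv c" using mem_scale_lattice_iff[OF assms(1) c(1,2) assms(3)] assms(4) by simp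
    then show False using c less by simp
  qed
  show ?thesis
  proof (cases "x \<in> N")
    case True
    then show ?thesis using mem_lattice_iff[OF N(1) assms(3)] ge by simp
  next
    case False
    then have "1 < lattice_norm absv K N x" using mem_lattice_iff[OF N(1) assms(3)] by simp
    then show ?thesis using value_group_gt_1[OF vg] le False by simp
  qed
qed

text \<open>
  The neighbours of \<open>M\<close> are the lines of the plane \<open>M / unif M\<close> over the residue field, and a
  primitive vector spans one line.
\<close>

lemma ex1_neighbour_through_primitive:
  assumes "M \<in> lattices absv K" "x \<in> K2 K" "lattice_norm absv K M x = 1"
  shows "\<exists>!N. N \<in> neighbours M \<and> x \<in> N"
proof -
  obtain y where y: "basis x y" "M = lattice_span x y" using complete_to_basis[OF assms] .
  define N0 where "N0 = lattice_span x (unif *s y)"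
  have b0: "basis x (unif *s y)"
    using y(1) unif_nonzero by (auto simp: basis_def K2_scale unif_mem wedge_def algebra_simps)
  have N0: "N0 \<in> lattices absv K" unfolding N0_def lattices_eq using b0 by blast
  have mem_N0: "a *s x + b *s y \<in> N0 \<longleftrightarrow> absv a \<le> 1 \<and> absv b \<le> absv unif"
    if ab: "a \<in> K" "b \<in> K" for a b
  proof -
    have "a *s x + b *s y = a *s x + (b / unif) *s (unif *s y)"
      using unif_nonzero by (simp add: vector_smult_assoc)
    moreover have "a *s x + b *s y \<in> K2 K" using ab y by (simp add: basis_def K2_add K2_scale)
    ultimately show ?thesis
      using mem_lattice_iff[OF N0] lattice_norm_span[OF b0, of a "b / unif"] ab unif_mem absv_unif(1)
      by (simp add: N0_def divide_mem absv_divide divide_le_eq)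
  qed
  have mem_M: "a *s x + b *s y \<in> M \<longleftrightarrow> absv a \<le> 1 \<and> absv b \<le> 1"
    and mem_uM: "a *s x + b *s y \<in> (*s) unif ` M \<longleftrightarrow> absv a \<le> absv unif \<and> absv b \<le> absv unif"
    if ab: "a \<in> K" "b \<in> K" for a b
  proof -
    have k: "a *s x + b *s y \<in> K2 K" using ab y by (simp add: basis_def K2_add K2_scale)
    show "a *s x + b *s y \<in> M \<longleftrightarrow> absv a \<le> 1 \<and> absv b \<le> 1"
      using mem_lattice_iff[OF assms(1) k] lattice_norm_span[OF y(1) ab] y(2) by simp
    show "a *s x + b *s y \<in> (*s) unif ` M \<longleftrightarrow> absv a \<le> absv unif \<and> absv b \<le> absv unif"
      using mem_scale_lattice_iff[OF assms(1) unif_mem unif_nonzero k] lattice_norm_span[OF y(1) ab] y(2) by simp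
  qed
  have coord: "\<exists>a\<in>K. \<exists>b\<in>K. s = a *s x + b *s y" if "s \<in> K2 K" for s
    using basis_coordinates[OF y(1) that] by metis
  have K2: "N0 \<subseteq> K2 K" "M \<subseteq> K2 K" "(*s) unif ` M \<subseteq> K2 K"
    using lattice_sub_K2 N0 assms(1) scale_lattice(1)[OF assms(1) unif_mem unif_nonzero] by auto
  have x: "x = 1 *s x + 0 *s y" and y': "y = 0 *s x + 1 *s y" by auto
  have "(*s) unif ` M \<subseteq> N0"
  proof
    fix s assume s: "s \<in> (*s) unif ` M"
    obtain a b where "a \<in> K" "b \<in> K" "s = a *s x + b *s y" using coord K2 s by blast
    then show "s \<in> N0" using s mem_uM mem_N0 absv_unif(2) by force
  qed
  moreover have "N0 \<subseteq> M"
  proof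
    fix s assume s: "s \<in> N0"
    obtain a b where "a \<in> K" "b \<in> K" "s = a *s x + b *s y" using coord K2 s by blast
    then show "s \<in> M" using s mem_M mem_N0 absv_unif(2) by force
  qed
  moreover have x_N0: "x \<in> N0" using mem_N0[OF one_mem zero_mem] x absv_unif(1) by simp
  moreover have "x \<notin> (*s) unif ` M" using mem_uM[OF one_mem zero_mem] x absv_unif(2) by simp
  moreover have "y \<in> M" "y \<notin> N0"
    using mem_M[OF zero_mem one_mem] mem_N0[OF zero_mem one_mem] y' absv_unif by auto
  ultimately have "N0 \<in> neighbours M" using N0 by (auto simp: neighbours_def)
  moreover have "N = N0" if N: "N \<in> neighbours M" "x \<in> N" for N
  proof (intro antisym subsetI)
    have lat: "N \<in> lattices absv K" and sub: "(*s) unif ` M \<subseteq> N" "N \<subset> M"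
      using N(1) by (auto simp: neighbours_def)
    show "s \<in> N" if s: "s \<in> N0" for s
    proof -
      obtain a b where ab: "a \<in> \<O>" "b \<in> \<O>" "s = a *s x + b *s (unif *s y)"
        using s unfolding N0_def lattice_span_def by blast
      have "unif *s y \<in> N" using sub(1) \<open>y \<in> M\<close> by blast
      then show ?thesis using lattice_combination[OF lat N(2)] ab by metis
    qed
    show "s \<in> N0" if s: "s \<in> N" for s
    proof (rule ccontr)
      assume "s \<notin> N0"
      have "s \<in> M" using s sub(2) by blast
      obtain a b where ab: "a \<in> K" "b \<in> K" "s = a *s x + b *s y" using coord K2(2) \<open>s \<in> M\<close> by blast
      have le: "absv a \<le> 1" "absv b \<le> 1" using mem_M ab \<open>s \<in> M\<close> by auto
      then have "absv b = 1"
        using mem_N0[OF ab(1,2)] ab(3) \<open>s \<notin> N0\<close> absv_le_unif[OF ab(2)] by fastforce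
      \<comment> \<open>Then \<open>N\<close> contains \<open>y\<close> as well, and is not a proper sublattice.\<close>
      then have "b \<noteq> 0" by auto
      then have "y = (1 / b) *s s + (- a / b) *s x" using ab(3) by (simp add: vec_eq_iff field_simps)
      moreover have "1 / b \<in> \<O>" "- a / b \<in> \<O>"
        using \<open>absv b = 1\<close> le ab by (auto simp: integer_ring_iff absv_divide field_mem)
      ultimately have "y \<in> N" using lattice_combination[OF lat s N(2)] by metis
      then have "M \<subseteq> N" unfolding y(2) lattice_span_def using lattice_combination[OF lat N(2)] by blast
      then show False using sub(2) by blast
    qed
  qed
  ultimately show ?thesis using x_N0 by blast
qed

text \<open>
  Every neighbour contains a primitive vector among the finitely many representatives of \<open>M\<close>
  modulo \<open>unif\<close>, and is the only one to contain it.
\<close>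

lemma finite_neighbours:
  assumes M: "M \<in> lattices absv K"
  shows "finite (neighbours M)"
proof -
  obtain v w where vw: "basis v w" "M = lattice_span v w" using M by (auto simp: lattices_eq)
  obtain R where R: "finite R" "R \<subseteq> \<O>" "\<And>x. x \<in> \<O> \<Longrightarrow> \<exists>r\<in>R. absv (x - r) < 1"
    using finite_residue_system by blast
  define S where "S = (\<lambda>(r, r'). r *s v + r' *s w) ` (R \<times> R)"
  have "finite S" using R(1) by (simp add: S_def)
  have SM: "S \<subseteq> M" using R(2) unfolding S_def vw(2) lattice_span_def by auto
  have rep: "\<exists>s. s \<in> S \<and> s \<in> N \<and> lattice_norm absv K M s = 1" if N: "N \<in> neighbours M" for N
  proof -
    have lat: "N \<in> lattices absv K" and sub: "(*s) unif ` M \<subset> N" "N \<subset> M"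
      using N by (auto simp: neighbours_def)
    obtain x where x: "x \<in> N" "x \<notin> (*s) unif ` M" using sub(1) by blast
    obtain a b where ab: "a \<in> \<O>" "b \<in> \<O>" "x = a *s v + b *s w"
      using x(1) sub(2) unfolding vw(2) lattice_span_def by blast
    obtain r r' where r: "r \<in> R" "absv (a - r) < 1" "r' \<in> R" "absv (b - r') < 1"
      using R(3) ab by meson
    define s where "s = r *s v + r' *s w"
    have sS: "s \<in> S" using r by (auto simp: S_def s_def)
    have K: "a \<in> K" "b \<in> K" "r \<in> K" "r' \<in> K" using ab r R(2) by (auto simp: integer_ring_iff)
    have d: "x - s = (a - r) *s v + (b - r') *s w" by (simp add: ab s_def vec_eq_iff algebra_simps)
    have "x - s \<in> K2 K" unfolding d using K vw(1) unfolding basis_def by (intro K2_add K2_scale diff_mem) auto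
    then have xs: "x - s \<in> (*s) unif ` M"
      using mem_scale_lattice_iff[OF M unif_mem unif_nonzero] absv_le_unif K r
        lattice_norm_span[OF vw(1), of "a - r" "b - r'"] by (simp add: d vw(2) diff_mem)
    have comb: "1 \<in> \<O>" "-1 \<in> \<O>" by (auto simp: integer_ring_iff field_mem)
    have "1 *s x + (-1) *s (x - s) \<in> N" using xs sub(1) by (intro lattice_combination lat x(1) comb) blast
    then have "s \<in> N" by (simp add: vec_eq_iff)
    have "s \<in> M" using SM sS by blast
    then have sK: "s \<in> K2 K" using lattice_sub_K2[OF M] by blast
    have "lattice_norm absv K M s = 1"
    proof (rule ccontr)
      assume "lattice_norm absv K M s \<noteq> 1"
      then have "lattice_norm absv K M s < 1" using mem_lattice_iff[OF M sK] \<open>s \<in> M\<close> by simp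
      then have "s \<in> (*s) unif ` M"
        using mem_scale_lattice_iff[OF M unif_mem unif_nonzero sK] lattice_norm_less_1[OF M sK] by simp
      then have "1 *s s + 1 *s (x - s) \<in> (*s) unif ` M"
        by (intro lattice_combination scale_lattice(1) M unif_mem unif_nonzero xs comb)
      then show False using x(2) by simp
    qed
    then show ?thesis using sS \<open>s \<in> N\<close> by blast
  qed
  then obtain F where F: "\<And>N. N \<in> neighbours M \<Longrightarrow> F N \<in> S \<and> F N \<in> N \<and> lattice_norm absv K M (F N) = 1"
    by metis
  have "inj_on F (neighbours M)"
  proof (rule inj_onI)
    fix N N' assume N: "N \<in> neighbours M" "N' \<in> neighbours M" "F N = F N'"
    have "F N \<in> K2 K" using F[OF N(1)] SM lattice_sub_K2[OF M] by blast
    then show "N = N'" using ex1_neighbour_through_primitive[OF M, of "F N"] F N by metis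
  qed
  then show ?thesis using F \<open>finite S\<close> by (intro inj_on_finite[of F _ S]) auto
qed

lemma neighbours_nonempty:
  assumes M: "M \<in> lattices absv K"
  shows "neighbours M \<noteq> {}"
proof -
  obtain v w where vw: "basis v w" "M = lattice_span v w" using M by (auto simp: lattices_eq)
  have "lattice_norm absv K M v = 1"
    using lattice_norm_span[OF vw(1) one_mem zero_mem] by (simp add: vw(2))
  then show ?thesis using ex1_neighbour_through_primitive[OF M] vw(1) by (auto simp: basis_def)
qed

text \<open>
  The logarithm of the norm of a fixed vector has, up to an additive constant that does not depend
  on the vector, the mean value property: after scaling the vector is primitive, its norm grows by
  the factor \<open>q\<close> at all neighbours but the one on its line, where it does not change.
\<close>

lemma sum_log_norm_neighbours:
  assumes M: "M \<in> lattices absv K" and x: "x \<in> K2 K" "x \<noteq> 0"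
  shows "(\<Sum>N\<in>neighbours M. log residue_size (lattice_norm absv K N x))
    = real (card (neighbours M)) * log residue_size (lattice_norm absv K M x)
      + (real (card (neighbours M)) - 1)"
proof -
  let ?q = residue_size
  note q = residue_size_gt_1
  obtain c where c: "c \<in> K" "c \<noteq> 0" "absv c = lattice_norm absv K M x"
    using value_group_attained[OF lattice_norm_in_value_group[OF M x]] .
  define y where "y = (1 / c) *s x"
  have y: "y \<in> K2 K" using x c by (simp add: y_def K2_scale field_mem)
  have y1: "lattice_norm absv K M y = 1"
    using lattice_norm_scale[OF M x(1), of "1 / c"] c lattice_norm_pos[OF M x]
    by (simp add: y_def field_mem absv_divide)
  have xy: "x = c *s y" using c by (simp add: y_def vector_smult_assoc)
  obtain N0 where N0: "N0 \<in> neighbours M" "y \<in> N0" "\<And>N. N \<in> neighbours M \<Longrightarrow> y \<in> N \<Longrightarrow> N = N0"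
    using ex1_neighbour_through_primitive[OF M y y1] by blast
  have "log ?q (lattice_norm absv K N x) = log ?q (absv c) + (if N = N0 then 0 else 1)"
    if N: "N \<in> neighbours M" for N
  proof -
    have lat: "N \<in> lattices absv K" using N by (simp add: neighbours_def)
    have "y \<in> N \<longleftrightarrow> N = N0" using N0(2,3) N by blast
    then have "lattice_norm absv K N y = (if N = N0 then 1 else ?q)"
      using neighbour_norm[OF M N y y1] by (simp only:)
    then have "lattice_norm absv K N x = absv c * (if N = N0 then 1 else ?q)"
      unfolding xy lattice_norm_scale[OF lat y c(1)] by simp
    then show ?thesis using c(2) q by (simp add: log_mult_pos)
  qed
  then have "(\<Sum>N\<in>neighbours M. log ?q (lattice_norm absv K N x))
      = (\<Sum>N\<in>neighbours M. log ?q (absv c) + (if N = N0 then 0 else 1))" by simp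
  also have "\<dots> = card (neighbours M) * log ?q (absv c) + (\<Sum>N\<in>neighbours M. if N = N0 then 0 else 1)"
    by (simp add: sum.distrib)
  also have "(\<Sum>N\<in>neighbours M. if N = N0 then 0 else 1) = (\<Sum>N\<in>neighbours M - {N0}. 1 :: real)"
    using finite_neighbours[OF M] N0(1) by (simp add: sum.remove)
  also have "\<dots> = real (card (neighbours M)) - 1"
    using card_Suc_Diff1[OF finite_neighbours[OF M] N0(1)] by simp
  finally show ?thesis using c(3) by simp
qed

text \<open>
  Multiplication by a nonunit \<open>c\<close> would move the neighbour \<open>N\<close> into \<open>unif M\<close>.
\<close>

lemma proportional_neighbours_eq:
  assumes M: "M \<in> lattices absv K" and N: "N \<in> neighbours M" "(*s) c ` N \<in> neighbours M"
    and c: "c \<in> K" "c \<noteq> 0" "absv c \<le> 1"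
  shows "(*s) c ` N = N"
proof -
  have lat: "N \<in> lattices absv K" using N by (simp add: neighbours_def)
  have "absv c = 1"
  proof (rule ccontr)
    assume "absv c \<noteq> 1"
    then have "(*s) c ` N \<subseteq> (*s) unif ` N"
      using c absv_le_unif[OF c(1)] by (intro scale_lattice_mono lat unif_mem unif_nonzero) auto
    also have "\<dots> \<subseteq> (*s) unif ` M" using N(1) by (auto simp: neighbours_def)
    finally show False using N(2) by (auto simp: neighbours_def)
  qed
  then have "(*s) c ` N = (*s) 1 ` N" using c by (intro scale_lattice_cong lat one_mem) auto
  then show ?thesis by (simp add: scale_one)
qed

text \<open>
  Adjacent vertices may be witnessed by lattices other than \<open>M\<close>, but scaling moves the larger
  lattice to \<open>M\<close>. After that the smaller lattice is determined by its class.
\<close>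

lemma bij_betw_neighbours:
  assumes v: "v \<in> bt_vertices absv K" "M \<in> v"
  shows "bij_betw (lattice_class K) (neighbours M) {w \<in> bt_vertices absv K. bt_adjacent absv K v w}"
proof -
  note M = vertex_elem(1)[OF v]
  have "inj_on (lattice_class K) (neighbours M)"
  proof (rule inj_onI)
    fix N N' assume N: "N \<in> neighbours M" "N' \<in> neighbours M" "lattice_class K N = lattice_class K N'"
    have "N' \<in> lattice_class K N" using N(3) lattice_class_self[of N'] by simp
    then obtain c where c: "c \<in> K" "c \<noteq> 0" "N' = (*s) c ` N" by (auto simp: lattice_class_def)
    then have c': "N = (*s) (1 / c) ` N'" by (simp add: scale_scale scale_one)
    show "N = N'"
    proof (cases "absv c \<le> 1")
      case True
      then show ?thesis using proportional_neighbours_eq[OF M N(1), of c] N(2) c by simp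
    next
      case False
      then have "1 / c \<in> K" "1 / c \<noteq> 0" "absv (1 / c) \<le> 1"
        using c by (auto simp: field_mem absv_divide)
      then show ?thesis
        using proportional_neighbours_eq[OF M N(2), of "1 / c", folded c'] N(1) by blast
    qed
  qed
  moreover have "lattice_class K ` neighbours M = {w \<in> bt_vertices absv K. bt_adjacent absv K v w}"
  proof (intro antisym subsetI)
    fix w assume "w \<in> lattice_class K ` neighbours M"
    then obtain N where N: "N \<in> neighbours M" and w: "w = lattice_class K N" by blast
    have "uniformizer absv K unif \<and> M \<in> v \<and> N \<in> w \<and> (*s) unif ` M \<subset> N \<and> N \<subset> M"
      using N unif(1) v(2) lattice_class_self unfolding w neighbours_def by simp
    then have "bt_adjacent absv K v w" unfolding bt_adjacent_def by (intro exI)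
    moreover have "w \<in> bt_vertices absv K" using N by (simp add: w bt_vertices_def neighbours_def)
    ultimately show "w \<in> {w \<in> bt_vertices absv K. bt_adjacent absv K v w}" by simp
  next
    fix w assume "w \<in> {w \<in> bt_vertices absv K. bt_adjacent absv K v w}"
    then obtain u M' N' where w: "w \<in> bt_vertices absv K" and u: "uniformizer absv K u"
      and MN: "M' \<in> v" "N' \<in> w" "(*s) u ` M' \<subset> N'" "N' \<subset> M'"
      by (auto simp: bt_adjacent_def)
    obtain c where c: "c \<in> K" "c \<noteq> 0" "M = (*s) c ` M'"
      using vertex_lattices_proportional[OF v(1) MN(1) v(2)] .
    define N where "N = (*s) c ` N'"
    have N: "N \<in> w" using vertex_scale[OF w MN(2) c(1,2)] by (simp add: N_def)
    have inj: "inj_on ((*s) c) S" for S :: "('c ^ 2) set"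
      using c(2) by (auto intro!: inj_onI simp: vec_eq_iff)
    have u': "u \<in> K" "u \<noteq> 0" using u by (auto simp: uniformizer_def)
    have "(*s) unif ` M = (*s) u ` M"
      using absv_uniformizer[OF u] u' by (intro scale_lattice_cong M unif_mem unif_nonzero) auto
    also have "\<dots> = (*s) c ` (*s) u ` M'" by (simp add: c(3) scale_scale mult.commute)
    finally have "(*s) unif ` M = (*s) c ` (*s) u ` M'" .
    then have "(*s) unif ` M \<subset> N" "N \<subset> M"
      using image_strict_mono[OF inj MN(3)] image_strict_mono[OF inj MN(4)] by (simp_all only: N_def c(3))
    then have "N \<in> neighbours M" using vertex_elem(1)[OF w N] by (simp add: neighbours_def)
    then show "w \<in> lattice_class K ` neighbours M" using vertex_elem(2)[OF w N] by blast
  qed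
  ultimately show ?thesis by (simp add: bij_betw_def)
qed

end


section \<open>Units on the complement of a set of rational points\<close>

context nonarchimedean_abs
begin

text \<open>
  Every root of a form without zeros on the affinoid is so close to a point of \<open>L\<close> that it can be
  moved there without changing its distances to the points of the affinoid.
\<close>

lemma absv_form_value_on_affinoid:
  assumes "P \<noteq> 0" "degree P \<le> d" and nz: "\<And>z. z \<in> affinoid absv L \<epsilon> \<Longrightarrow> form_value d P z \<noteq> 0"
  shows "\<exists>x. (\<forall>i<d. x i \<in> L) \<and> (\<forall>z\<in>affinoid absv L \<epsilon>.
    absv (form_value d P z) = gauss_norm P * sup_norm (hcoord z) ^ d * (\<Prod>i<d. chordal absv (x i) z))"
proof -
  obtain b where b: "\<And>z. absv (form_value d P z)
      = gauss_norm P * sup_norm (hcoord z) ^ d * (\<Prod>i<d. chordal absv (b i) z)"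
    using absv_form_value[OF assms(1,2)] by blast
  have "\<exists>x\<in>L. chordal absv (b i) x < \<epsilon>" if i: "i < d" for i
  proof -
    have "(\<Prod>j<d. chordal absv (b j) (b i)) = 0" using i by (intro prod_zero bexI[of _ i]) auto
    then have "absv (form_value d P (b i)) = 0" unfolding b by simp
    then have "form_value d P (b i) = 0" by (simp add: abs_zero_iff)
    then show ?thesis using nz[of "b i"] by (force simp: affinoid_def)
  qed
  then obtain x where x: "\<And>i. i < d \<Longrightarrow> x i \<in> L \<and> chordal absv (b i) (x i) < \<epsilon>" by metis
  have "chordal absv (b i) z = chordal absv (x i) z" if "i < d" "z \<in> affinoid absv L \<epsilon>" for i z
    using x[OF that(1)] that(2) by (intro chordal_eq_of_close[of _ _ \<epsilon>]) (auto simp: affinoid_def)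
  then have "absv (form_value d P z) = gauss_norm P * sup_norm (hcoord z) ^ d * (\<Prod>i<d. chordal absv (x i) z)"
    if "z \<in> affinoid absv L \<epsilon>" for z using that by (simp add: b)
  then show ?thesis using x by blast
qed

lemma affinoid_chordal_ge:
  "z \<in> affinoid absv L \<epsilon> \<Longrightarrow> x \<in> L \<Longrightarrow> \<epsilon> \<le> chordal absv x z"
  by (simp add: affinoid_def chordal_commute[of x])

text \<open>
  The numerator is bounded by its Gauss norm; the denominator is bounded below because its roots
  can be moved to points of \<open>L\<close>, which have distance at least \<open>\<epsilon>\<close> from the affinoid.
\<close>

lemma regular_rational_bounded:
  assumes R: "R \<in> regular_rational K (affinoid absv L \<epsilon>)" and "0 < \<epsilon>"
  shows "\<exists>B>0. \<forall>z\<in>affinoid absv L \<epsilon>. absv (R z) \<le> B"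
proof (cases "affinoid absv L \<epsilon> = {}")
  case True
  then show ?thesis by (auto intro: exI[of _ 1])
next
  case False
  obtain d P Q where R_def: "R = (\<lambda>z. form_value d P z / form_value d Q z)"
    and deg: "degree P \<le> d" "degree Q \<le> d" and nz: "\<And>z. z \<in> affinoid absv L \<epsilon> \<Longrightarrow> form_value d Q z \<noteq> 0"
    using R by (auto simp: regular_rational_def)
  have "Q \<noteq> 0" using False nz by (auto simp: form_value_def)
  then obtain y where y: "\<And>i. i < d \<Longrightarrow> y i \<in> L" "\<And>z. z \<in> affinoid absv L \<epsilon> \<Longrightarrow>
      absv (form_value d Q z) = gauss_norm Q * sup_norm (hcoord z) ^ d * (\<Prod>i<d. chordal absv (y i) z)"
    using absv_form_value_on_affinoid[OF _ deg(2) nz] by blast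
  have Qpos: "0 < gauss_norm Q" using \<open>Q \<noteq> 0\<close> by (rule gauss_norm_pos)
  have Pge: "0 \<le> gauss_norm P" using absv_coeff_le_gauss_norm[of P 0] abs_nonneg[of "coeff P 0"] by linarith
  define B where "B = gauss_norm P / (gauss_norm Q * \<epsilon> ^ d)"
  have "absv (R z) \<le> B" if z: "z \<in> affinoid absv L \<epsilon>" for z
  proof -
    let ?s = "sup_norm (hcoord z) ^ d"
    have s: "0 < ?s" using sup_norm_hcoord_pos by simp
    have "absv (form_value d P z) \<le> gauss_norm P * ?s"
    proof (cases "P = 0")
      case True
      then show ?thesis using Pge s by (simp add: form_value_def)
    next
      case False
      obtain b where b: "absv (form_value d P z) = gauss_norm P * ?s * (\<Prod>i<d. chordal absv (b i) z)"
        using absv_form_value[OF False deg(1)] by blast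
      have "(\<Prod>i<d. chordal absv (b i) z) \<le> 1" by (intro prod_le_1) (auto simp: chordal_nonneg chordal_le_1)
      then show ?thesis unfolding b using Pge s by (intro mult_left_le) auto
    qed
    moreover have "gauss_norm Q * ?s * \<epsilon> ^ d \<le> absv (form_value d Q z)"
    proof -
      have "(\<Prod>i<d. \<epsilon>) \<le> (\<Prod>i<d. chordal absv (y i) z)"
        using y(1) affinoid_chordal_ge[OF z] \<open>0 < \<epsilon>\<close> by (intro prod_mono) auto
      then show ?thesis unfolding y(2)[OF z] using Qpos s by simp
    qed
    ultimately have "absv (R z) \<le> (gauss_norm P * ?s) / (gauss_norm Q * ?s * \<epsilon> ^ d)"
      unfolding R_def absv_divide using Qpos s \<open>0 < \<epsilon>\<close> Pge by (intro frac_le) auto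
    also have "\<dots> = B" using sup_norm_hcoord_pos[of z] by (simp add: B_def)
    finally show ?thesis .
  qed
  then show ?thesis by (intro exI[of _ "max 1 B"]) (auto simp: le_max_iff_disj)
qed

end

context padic_field
begin

lemma gauss_norm_in_value_group:
  assumes "P \<noteq> 0" "\<And>i. coeff P i \<in> K"
  shows "gauss_norm P \<in> value_group"
proof -
  obtain i where i: "gauss_norm P = absv (coeff P i)" using gauss_norm_attained by blast
  then have "coeff P i \<noteq> 0" using gauss_norm_pos[OF assms(1)] by auto
  then show ?thesis using i assms(2) absv_in_value_group by simp
qed

text \<open>
  The inverse of the unit is bounded on the affinoid, so that the absolute value of the unit is
  bounded below there and agrees with that of a sufficiently good rational approximation. The
  numerator and the denominator of the latter have no zeros on the affinoid.
\<close>

lemma absv_unit_on_affinoid: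
  assumes f: "f \<in> holomorphic_units absv K L" and \<epsilon>: "0 < \<epsilon>" and ne: "affinoid absv L \<epsilon> \<noteq> {}"
  obtains A and d :: nat and x y where "A \<in> value_group" "\<And>i. i < d \<Longrightarrow> x i \<in> L" "\<And>i. i < d \<Longrightarrow> y i \<in> L"
    "\<And>z. z \<in> affinoid absv L \<epsilon> \<Longrightarrow>
      absv (f z) = A * (\<Prod>i<d. chordal absv (x i) z / chordal absv (y i) z)"
proof -
  let ?S = "affinoid absv L \<epsilon>"
  obtain h where fo: "f \<in> holomorphic_off absv K L" and ho: "h \<in> holomorphic_off absv K L"
    and fh: "\<And>z. z \<notin> L \<Longrightarrow> f z * h z = 1"
    using f by (auto simp: holomorphic_units_def)
  have SL: "z \<notin> L" if "z \<in> ?S" for z using that \<epsilon> by (force simp: affinoid_def)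
  obtain R' where R': "R' \<in> regular_rational K ?S" "\<And>z. z \<in> ?S \<Longrightarrow> absv (h z - R' z) < 1"
    using ho \<epsilon> zero_less_one unfolding holomorphic_off_def by blast
  obtain B where B: "B > 0" "\<And>z. z \<in> ?S \<Longrightarrow> absv (R' z) \<le> B"
    using regular_rational_bounded[OF R'(1) \<epsilon>] by blast
  define C where "C = max 1 B"
  have C: "C > 0" by (simp add: C_def)
  have f_ge: "1 / C \<le> absv (f z)" if z: "z \<in> ?S" for z
  proof -
    have "absv (h z) \<le> C"
      using abs_ultrametric[of "h z - R' z" "R' z"] R'(2)[OF z] B(2)[OF z] by (auto simp: C_def)
    moreover have "absv (f z) * absv (h z) = 1" using fh[OF SL[OF z]] by (simp flip: abs_mult)
    ultimately show ?thesis using C abs_nonneg[of "f z"]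
      by (metis divide_le_eq mult_left_mono)
  qed
  obtain R where R: "R \<in> regular_rational K ?S" "\<And>z. z \<in> ?S \<Longrightarrow> absv (f z - R z) < 1 / C"
  proof -
    have "0 < 1 / C" using C by simp
    then show ?thesis using that fo \<epsilon> unfolding holomorphic_off_def by blast
  qed
  have fR: "absv (f z) = absv (R z)" if "z \<in> ?S" for z
    using absv_eq_of_close[of "f z" "R z"] R(2)[OF that] f_ge[OF that] by simp
  obtain d P Q where R_def: "R = (\<lambda>z. form_value d P z / form_value d Q z)"
    and deg: "degree P \<le> d" "degree Q \<le> d" and co: "\<And>i. coeff P i \<in> K" "\<And>i. coeff Q i \<in> K"
    and Qz: "\<And>z. z \<in> ?S \<Longrightarrow> form_value d Q z \<noteq> 0"
    using R(1) by (auto simp: regular_rational_def)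
  have Pz: "form_value d P z \<noteq> 0" if "z \<in> ?S" for z
  proof
    assume "form_value d P z = 0"
    then have "absv (f z) = 0" using fR[OF that] by (simp add: R_def)
    moreover have "0 < absv (f z)" using f_ge[OF that] C by (meson divide_pos_pos less_le_trans zero_less_one)
    ultimately show False by simp
  qed
  have P0: "P \<noteq> 0" and Q0: "Q \<noteq> 0" using ne Pz Qz by (auto simp: form_value_def)
  obtain x where x: "\<And>i. i < d \<Longrightarrow> x i \<in> L" "\<And>z. z \<in> ?S \<Longrightarrow>
      absv (form_value d P z) = gauss_norm P * sup_norm (hcoord z) ^ d * (\<Prod>i<d. chordal absv (x i) z)"
    using absv_form_value_on_affinoid[OF P0 deg(1) Pz] by blast
  obtain y where y: "\<And>i. i < d \<Longrightarrow> y i \<in> L" "\<And>z. z \<in> ?S \<Longrightarrow>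
      absv (form_value d Q z) = gauss_norm Q * sup_norm (hcoord z) ^ d * (\<Prod>i<d. chordal absv (y i) z)"
    using absv_form_value_on_affinoid[OF Q0 deg(2) Qz] by blast
  define A where "A = gauss_norm P / gauss_norm Q"
  have "A \<in> value_group"
    unfolding A_def using P0 Q0 co by (intro value_group_divide gauss_norm_in_value_group)
  moreover have "absv (f z) = A * (\<Prod>i<d. chordal absv (x i) z / chordal absv (y i) z)" if z: "z \<in> ?S" for z
    using fR[OF z] sup_norm_hcoord_pos[of z]
    by (simp add: R_def absv_divide x(2)[OF z] y(2)[OF z] A_def prod_dividef)
  ultimately show ?thesis using x(1) y(1) by (intro that[of A d x y])
qed

text \<open>
  Dividing by the sup-norm makes the value independent of the homogeneous coordinates of the point.
  For \<open>z\<close> in the fibre over the class of \<open>M\<close>, it is the logarithm of the chordal distance from \<open>x\<close>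
  to \<open>z\<close> up to a constant that depends on \<open>z\<close> only.
\<close>

definition log_height :: "('c ^ 2) set \<Rightarrow> 'c proj \<Rightarrow> real" where
  "log_height M x = log residue_size (lattice_norm absv K M (hcoord x) / sup_norm (hcoord x))"

lemma lattice_norm_hcoord_pos:
  "M \<in> lattices absv K \<Longrightarrow> x \<in> P1 K \<Longrightarrow> 0 < lattice_norm absv K M (hcoord x)"
  by (intro lattice_norm_pos hcoord_K2 hcoord_nonzero)

lemma log_height_Ints:
  assumes "M \<in> lattices absv K" "x \<in> P1 K"
  shows "log_height M x \<in> \<int>"
proof -
  have "sup_norm (hcoord x) \<in> value_group"
  proof (cases x)
    case Infinity
    then show ?thesis using absv_in_value_group[OF one_mem] by (simp add: sup_norm_def)
  next
    case (Affine z)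
    then show ?thesis
      using assms(2) absv_in_value_group[OF one_mem] absv_in_value_group[of z]
      by (cases "z = 0") (auto simp: sup_norm_def P1_def max_def)
  qed
  then show ?thesis
    unfolding log_height_def using assms
    by (intro log_value_group value_group_divide lattice_norm_in_value_group hcoord_K2 hcoord_nonzero)
qed

lemma sum_log_height_neighbours:
  assumes "M \<in> lattices absv K" "x \<in> P1 K"
  shows "(\<Sum>N\<in>neighbours M. log_height N x)
    = real (card (neighbours M)) * log_height M x + (real (card (neighbours M)) - 1)"
proof -
  have lh: "log_height N x = log residue_size (lattice_norm absv K N (hcoord x)) - log residue_size (sup_norm (hcoord x))"
    if "N \<in> lattices absv K" for N
    unfolding log_height_def
    using lattice_norm_hcoord_pos[OF that assms(2)] sup_norm_hcoord_pos[of x] by (simp add: log_divide_pos)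
  have "(\<Sum>N\<in>neighbours M. log_height N x) = (\<Sum>N\<in>neighbours M.
      log residue_size (lattice_norm absv K N (hcoord x)) - log residue_size (sup_norm (hcoord x)))"
    by (intro sum.cong lh) (auto simp: neighbours_def)
  then show ?thesis
    using sum_log_norm_neighbours[OF assms(1) hcoord_K2[OF assms(2)] hcoord_nonzero]
    by (simp add: sum_subtractf lh[OF assms(1)] algebra_simps)
qed

text \<open>
  Near finitely many vertices the sup-norm of a unit is given by one formula: on a fibre the
  chordal distances to the points \<open>x i\<close> and \<open>y i\<close> are the norms of the lattice, up to a common
  factor, which cancels because there are as many zeros as poles. In particular the absolute
  value of a unit is constant on every fibre.
\<close>

lemma log_sup_norm_unit:
  assumes f: "f \<in> holomorphic_units absv K L" and L: "L \<subseteq> P1 K"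
    and V: "finite V" "V \<subseteq> bt_vertices absv K" "V \<noteq> {}"
  obtains a and d :: nat and x y where "a \<in> \<int>" "\<And>i. i < d \<Longrightarrow> x i \<in> P1 K" "\<And>i. i < d \<Longrightarrow> y i \<in> P1 K"
    "\<And>v M. v \<in> V \<Longrightarrow> M \<in> v \<Longrightarrow>
      log_sup_norm absv K f v = a + (\<Sum>i<d. log_height M (x i) - log_height M (y i))"
proof -
  let ?q = residue_size
  obtain \<epsilon> where \<epsilon>: "\<epsilon> > 0" "\<And>v. v \<in> V \<Longrightarrow> drinfeld_fibre absv K v \<subseteq> affinoid absv L \<epsilon>"
    using fibres_sub_affinoid[OF V(1,2) L] by blast
  have ne: "affinoid absv L \<epsilon> \<noteq> {}"
    using V \<epsilon>(2) drinfeld_fibre_nonempty by fastforce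
  obtain A and d :: nat and x y where A: "A \<in> value_group" and xy: "\<And>i. i < d \<Longrightarrow> x i \<in> L" "\<And>i. i < d \<Longrightarrow> y i \<in> L"
    and fz: "\<And>z. z \<in> affinoid absv L \<epsilon> \<Longrightarrow>
      absv (f z) = A * (\<Prod>i<d. chordal absv (x i) z / chordal absv (y i) z)"
    by (rule absv_unit_on_affinoid[OF f \<epsilon>(1) ne]) (rule that)
  have xy': "x i \<in> P1 K" "y i \<in> P1 K" if "i < d" for i using xy[OF that] L by auto
  have "log_sup_norm absv K f v = log ?q A + (\<Sum>i<d. log_height M (x i) - log_height M (y i))"
    if v: "v \<in> V" "M \<in> v" for v M
  proof -
    have vert: "v \<in> bt_vertices absv K" using v V by blast
    note lat = vertex_elem(1)[OF vert v(2)]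
    let ?\<rho> = "\<lambda>x. lattice_norm absv K M (hcoord x) / sup_norm (hcoord x)"
    have pos: "0 < ?\<rho> p" if "p \<in> P1 K" for p
      using lattice_norm_hcoord_pos[OF lat that] sup_norm_hcoord_pos[of p] by simp
    define c where "c = A * (\<Prod>i<d. ?\<rho> (x i) / ?\<rho> (y i))"
    have const: "absv (f z) = c" if z: "z \<in> drinfeld_fibre absv K v" for z
    proof -
      obtain t where t: "t > 0" "\<And>p. p \<in> P1 K \<Longrightarrow> chordal absv p z = t * ?\<rho> p"
        using chordal_on_fibre[OF vert v(2) z] by blast
      have "chordal absv (x i) z / chordal absv (y i) z = ?\<rho> (x i) / ?\<rho> (y i)" if "i < d" for i
        unfolding t(2)[OF xy'(1)[OF that]] t(2)[OF xy'(2)[OF that]] using t(1) by simp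
      then show ?thesis using fz \<epsilon>(2)[OF v(1)] z by (auto simp: c_def)
    qed
    have "(SUP z\<in>drinfeld_fibre absv K v. absv (f z)) = (SUP z\<in>drinfeld_fibre absv K v. c)"
      by (intro SUP_cong refl const)
    also have "\<dots> = c" using drinfeld_fibre_nonempty[OF vert] by simp
    finally have "log_sup_norm absv K f v = log ?q c" by (simp add: log_sup_norm_def residue_size_def)
    also have "\<dots> = log ?q A + log ?q (\<Prod>i<d. ?\<rho> (x i) / ?\<rho> (y i))"
      unfolding c_def
      by (intro log_mult_pos value_group_pos[OF A] prod_pos divide_pos_pos[OF pos pos] xy') auto
    also have "log ?q (\<Prod>i<d. ?\<rho> (x i) / ?\<rho> (y i)) = (\<Sum>i<d. log ?q (?\<rho> (x i) / ?\<rho> (y i)))"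
    proof -
      have "ln (\<Prod>i<d. ?\<rho> (x i) / ?\<rho> (y i)) = (\<Sum>i<d. ln (?\<rho> (x i) / ?\<rho> (y i)))"
      proof (rule ln_prod[OF finite_lessThan])
        fix i assume "i \<in> {..<d}"
        then have "0 < ?\<rho> (x i) / ?\<rho> (y i)" by (intro divide_pos_pos[OF pos pos] xy') auto
        then show "?\<rho> (x i) / ?\<rho> (y i) \<noteq> 0" by (rule less_imp_neq[symmetric])
      qed
      then show ?thesis by (simp only: log_def sum_divide_distrib)
    qed
    also have "\<dots> = (\<Sum>i<d. log_height M (x i) - log_height M (y i))"
      unfolding log_height_def using pos xy' by (intro sum.cong refl log_divide_pos) auto
    finally show ?thesis .
  qed
  then show ?thesis using that[of "log ?q A" d x y] log_value_group[OF A] xy' by blast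
qed

lemma log_sup_norm_unit_Ints:
  assumes f: "f \<in> holomorphic_units absv K L" and L: "L \<subseteq> P1 K" and v: "v \<in> bt_vertices absv K"
  shows "log_sup_norm absv K f v \<in> \<int>"
proof -
  obtain M where M: "M \<in> v" using vertex_nonempty[OF v] by blast
  note lat = vertex_elem(1)[OF v M]
  have V: "finite {v}" "{v} \<subseteq> bt_vertices absv K" "{v} \<noteq> {}" using v by auto
  obtain a and d :: nat and x y where formula: "a \<in> \<int>" "\<And>i. i < d \<Longrightarrow> x i \<in> P1 K" "\<And>i. i < d \<Longrightarrow> y i \<in> P1 K"
    "\<And>w M. w \<in> {v} \<Longrightarrow> M \<in> w \<Longrightarrow>
      log_sup_norm absv K f w = a + (\<Sum>i<d. log_height M (x i) - log_height M (y i))"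
    by (rule log_sup_norm_unit[OF f L V]) (rule that)
  have "(\<Sum>i<d. log_height M (x i) - log_height M (y i)) \<in> \<int>"
    using formula(2,3) log_height_Ints[OF lat] by (intro Ints_sum Ints_diff) auto
  then show ?thesis using formula(1) formula(4)[of v M] M by simp
qed

text \<open>
  The mean value property is exact here: the additive constants of \<open>sum_log_height_neighbours\<close> for
  the zeros and for the poles cancel.
\<close>

lemma sum_log_sup_norm_unit_neighbours:
  assumes f: "f \<in> holomorphic_units absv K L" and L: "L \<subseteq> P1 K"
    and v: "v \<in> bt_vertices absv K" "M \<in> v"
  shows "(\<Sum>N\<in>neighbours M. log_sup_norm absv K f (lattice_class K N))
    = real (card (neighbours M)) * log_sup_norm absv K f v"
proof -
  let ?n = "real (card (neighbours M))"
  note lat = vertex_elem(1)[OF v]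
  define V where "V = insert v (lattice_class K ` neighbours M)"
  have V: "finite V" "V \<subseteq> bt_vertices absv K" "V \<noteq> {}"
    using finite_neighbours[OF lat] v(1) by (auto simp: V_def neighbours_def bt_vertices_def)
  obtain a and d :: nat and x y where formula: "a \<in> \<int>" "\<And>i. i < d \<Longrightarrow> x i \<in> P1 K" "\<And>i. i < d \<Longrightarrow> y i \<in> P1 K"
    "\<And>w M. w \<in> V \<Longrightarrow> M \<in> w \<Longrightarrow>
      log_sup_norm absv K f w = a + (\<Sum>i<d. log_height M (x i) - log_height M (y i))"
    by (rule log_sup_norm_unit[OF f L V]) (rule that)
  have "(\<Sum>N\<in>neighbours M. log_sup_norm absv K f (lattice_class K N))
      = (\<Sum>N\<in>neighbours M. a + (\<Sum>i<d. log_height N (x i) - log_height N (y i)))"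
    using lattice_class_self by (intro sum.cong refl formula(4)) (auto simp: V_def)
  also have "\<dots> = ?n * a + (\<Sum>i<d. \<Sum>N\<in>neighbours M. log_height N (x i) - log_height N (y i))"
    using sum.swap[of _ "{..<d}" "neighbours M"] by (simp add: sum.distrib)
  also have "?n * a + (\<Sum>i<d. \<Sum>N\<in>neighbours M. log_height N (x i) - log_height N (y i))
      = ?n * a + (\<Sum>i<d. ?n * (log_height M (x i) - log_height M (y i)))"
  proof -
    have "(\<Sum>N\<in>neighbours M. log_height N (x i) - log_height N (y i))
        = ?n * (log_height M (x i) - log_height M (y i))" if "i < d" for i
      unfolding sum_subtractf sum_log_height_neighbours[OF lat formula(2)[OF that]]
        sum_log_height_neighbours[OF lat formula(3)[OF that]]
      by (simp add: right_diff_distrib)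
    then show ?thesis by simp
  qed
  also have "\<dots> = ?n * log_sup_norm absv K f v"
    using formula(4)[of v M] v(2) by (simp add: V_def sum_distrib_left distrib_left)
  finally show ?thesis .
qed

lemma limit_set_sub_P1: "limit_set absv K \<Gamma> \<subseteq> P1 K"
proof -
  let ?T = "subtopology (Metric_space.mtopology UNIV (chordal absv)) (P1 K)"
  have "limit_set absv K \<Gamma> \<subseteq> topspace ?T" unfolding limit_set_def by (rule closure_of_subset_topspace)
  then show ?thesis by (simp add: topspace_subtopology)
qed

end


section \<open>Harmonic functions as virtual graph weights\<close>

text \<open>
  The positive and the negative part of a harmonic function are subharmonic, with the same defect
  because their difference has defect 0. Spreading this defect evenly over the edges issuing from
  a vertex gives the common inhomogeneity.
\<close>

lemma harmonic_imp_rational_virtual_graph_weight: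
  fixes E :: "('v, 'e) pre_digraph" and g :: "'v \<Rightarrow> real"
  assumes arcs: "\<And>e. e \<in> arcs E \<Longrightarrow> tail E e \<in> verts E \<and> head E e \<in> verts E"
    and fin: "\<And>v. v \<in> verts E \<Longrightarrow> finite (out_arcs E v)"
    and ne: "\<And>v. v \<in> verts E \<Longrightarrow> out_arcs E v \<noteq> {}"
    and rat: "\<And>v. v \<in> verts E \<Longrightarrow> g v \<in> \<rat>"
    and harmonic: "\<And>v. v \<in> verts E \<Longrightarrow> (\<Sum>e\<in>out_arcs E v. g (head E e)) = real (out_degree E v) * g v"
  shows "rational_virtual_graph_weight E g (\<lambda>e. 1 / real (out_degree E (tail E e)))"
proof -
  define l where "l = (\<lambda>e. 1 / real (out_degree E (tail E e)))"
  define gp where "gp = (\<lambda>v. max (g v) 0)"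
  define gm where "gm = (\<lambda>v. max (- g v) 0)"
  define D where "D = (\<lambda>v. (\<Sum>e\<in>out_arcs E v. l e * gp (head E e)) - gp v)"
  define \<xi> where "\<xi> = (\<lambda>e. l e * D (tail E e))"
  have gpm: "g v = gp v - gm v" for v by (simp add: gp_def gm_def max_def)
  have deg: "0 < real (out_degree E v)" if "v \<in> verts E" for v
    using fin[OF that] ne[OF that] by (simp add: out_degree_def card_gt_0_iff)
  have mean: "(\<Sum>e\<in>out_arcs E v. l e * h e) = (\<Sum>e\<in>out_arcs E v. h e) / real (out_degree E v)" for h v
    unfolding sum_divide_distrib by (intro sum.cong) (auto simp: l_def out_arcs_def)
  have mean_const: "(\<Sum>e\<in>out_arcs E v. \<xi> e) = D v" if "v \<in> verts E" for v
  proof -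
    have "(\<Sum>e\<in>out_arcs E v. \<xi> e) = (\<Sum>e\<in>out_arcs E v. l e * D v)"
      unfolding \<xi>_def by (intro sum.cong) (auto simp: out_arcs_def)
    then show ?thesis unfolding mean using deg[OF that] by (simp add: out_degree_def)
  qed
  have mean_g: "(\<Sum>e\<in>out_arcs E v. l e * g (head E e)) = g v" if "v \<in> verts E" for v
    unfolding mean harmonic[OF that] using deg[OF that] by simp
  have D_nonneg: "0 \<le> D v" if v: "v \<in> verts E" for v
  proof -
    have "g v \<le> (\<Sum>e\<in>out_arcs E v. l e * gp (head E e))"
      unfolding mean_g[OF v, symmetric] by (intro sum_mono mult_left_mono) (auto simp: gp_def l_def)
    moreover have "0 \<le> (\<Sum>e\<in>out_arcs E v. l e * gp (head E e))"
      by (intro sum_nonneg mult_nonneg_nonneg) (auto simp: gp_def l_def)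
    ultimately show ?thesis by (simp add: D_def gp_def)
  qed
  have l: "l e \<in> \<rat>" "0 \<le> l e" for e by (auto simp: l_def)
  have gp_rat: "gp v \<in> \<rat>" and gm_rat: "gm v \<in> \<rat>" if "v \<in> verts E" for v
    using rat[OF that] by (auto simp: gp_def gm_def max_def)
  have "D v \<in> \<rat>" if v: "v \<in> verts E" for v
    unfolding D_def using arcs l(1) gp_rat v by (intro Rats_diff Rats_sum Rats_mult) (auto simp: out_arcs_def)
  then have \<xi>: "\<xi> e \<in> \<rat>" "0 \<le> \<xi> e" if "e \<in> arcs E" for e
    using arcs[OF that] l D_nonneg by (auto simp: \<xi>_def)
  have "inhomogeneous_graph_weight E gp l \<xi>"
    unfolding inhomogeneous_graph_weight_def using fin l \<xi> mean_const by (auto simp: gp_def D_def)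
  moreover have "inhomogeneous_graph_weight E gm l \<xi>"
  proof -
    have "gm v + (\<Sum>e\<in>out_arcs E v. \<xi> e) = (\<Sum>e\<in>out_arcs E v. l e * gm (head E e))" if v: "v \<in> verts E" for v
    proof -
      have "(\<Sum>e\<in>out_arcs E v. l e * gm (head E e))
          = (\<Sum>e\<in>out_arcs E v. l e * gp (head E e)) - (\<Sum>e\<in>out_arcs E v. l e * g (head E e))"
        unfolding sum_subtractf[symmetric] by (intro sum.cong) (auto simp: gpm algebra_simps)
      then show ?thesis using mean_const[OF v] mean_g[OF v] gpm[of v] by (simp add: D_def)
    qed
    then show ?thesis unfolding inhomogeneous_graph_weight_def using fin l \<xi> by (auto simp: gm_def)
  qed
  ultimately show ?thesis
    unfolding rational_virtual_graph_weight_def l_def[symmetric]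
    using rat l \<xi> gp_rat gm_rat gpm by (intro conjI ballI exI[of _ gp] exI[of _ gm] exI[of _ \<xi>]) auto
qed

context padic_field
begin

lemma out_arcs_bt_tree:
  "v \<in> bt_vertices absv K \<Longrightarrow>
    out_arcs (bt_tree absv K) v = Pair v ` {w \<in> bt_vertices absv K. bt_adjacent absv K v w}"
  by (auto simp: out_arcs_def bt_tree_def)

lemma sum_out_arcs_bt_tree:
  assumes "v \<in> bt_vertices absv K" "M \<in> v"
  shows "(\<Sum>e\<in>out_arcs (bt_tree absv K) v. h (head (bt_tree absv K) e))
    = (\<Sum>N\<in>neighbours M. h (lattice_class K N))"
proof -
  have "(\<Sum>e\<in>out_arcs (bt_tree absv K) v. h (head (bt_tree absv K) e))
      = (\<Sum>w | w \<in> bt_vertices absv K \<and> bt_adjacent absv K v w. h w)"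
    unfolding out_arcs_bt_tree[OF assms(1)] by (subst sum.reindex) (auto simp: inj_on_def bt_tree_def)
  also have "\<dots> = (\<Sum>N\<in>neighbours M. h (lattice_class K N))"
    using sum.reindex_bij_betw[OF bij_betw_neighbours[OF assms], of h] by simp
  finally show ?thesis .
qed

lemma bij_betw_out_arcs_bt_tree:
  assumes "v \<in> bt_vertices absv K" "M \<in> v"
  shows "bij_betw (\<lambda>N. (v, lattice_class K N)) (neighbours M) (out_arcs (bt_tree absv K) v)"
  using bij_betw_neighbours[OF assms] unfolding out_arcs_bt_tree[OF assms(1)]
  by (auto simp: bij_betw_def inj_on_def image_image[symmetric])

end

theorem lemma7p4:
  fixes absv :: "'c::{alg_closed_field, field_char_0} \<Rightarrow> real"
    and K :: "'c set" and p :: nat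
    and \<Gamma> :: "('c ^ 2 ^ 2) set set"
    and f :: "'c proj \<Rightarrow> 'c"
  assumes "padic_field absv K p"
    and "schottky_group absv K \<Gamma>"
    and "f \<in> theta_functions absv K \<Gamma>"
  shows "(\<forall>v\<in>verts (bt_tree absv K). log_sup_norm absv K f v \<in> \<int>) \<and>
    rational_virtual_graph_weight (bt_tree absv K) (log_sup_norm absv K f)
      (\<lambda>e. 1 / real (out_degree (bt_tree absv K) (tail (bt_tree absv K) e)))"
proof -
  interpret padic_field absv K p by (rule assms(1))
  let ?E = "bt_tree absv K" and ?g = "log_sup_norm absv K f"
  have f: "f \<in> holomorphic_units absv K (limit_set absv K \<Gamma>)"
    using assms(3) by (simp add: theta_functions_def)
  have verts: "verts ?E = bt_vertices absv K" by (simp add: bt_tree_def)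
  have ints: "?g v \<in> \<int>" if "v \<in> verts ?E" for v
    using log_sup_norm_unit_Ints[OF f limit_set_sub_P1] that by (simp add: verts)
  moreover have "rational_virtual_graph_weight ?E ?g (\<lambda>e. 1 / real (out_degree ?E (tail ?E e)))"
  proof (rule harmonic_imp_rational_virtual_graph_weight)
    show "tail ?E e \<in> verts ?E \<and> head ?E e \<in> verts ?E" if "e \<in> arcs ?E" for e
      using that by (auto simp: bt_tree_def)
    fix v assume "v \<in> verts ?E"
    then have v: "v \<in> bt_vertices absv K" by (simp add: verts)
    then obtain M where M: "M \<in> v" using vertex_nonempty by blast
    note lat = vertex_elem(1)[OF v M]
    note bij = bij_betw_out_arcs_bt_tree[OF v M]
    show "finite (out_arcs ?E v)" using bij_betw_finite[OF bij] finite_neighbours[OF lat] by simp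
    show "out_arcs ?E v \<noteq> {}" using bij neighbours_nonempty[OF lat] by (auto simp: bij_betw_def)
    show "?g v \<in> \<rat>" using ints \<open>v \<in> verts ?E\<close> Ints_subset_Rats by blast
    show "(\<Sum>e\<in>out_arcs ?E v. ?g (head ?E e)) = real (out_degree ?E v) * ?g v"
      unfolding sum_out_arcs_bt_tree[OF v M] out_degree_def bij_betw_same_card[OF bij, symmetric]
      by (rule sum_log_sup_norm_unit_neighbours[OF f limit_set_sub_P1 v M])
  qed
  ultimately show ?thesis by blast
qed

end
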